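(* (Provable in ZF, without the axiom of choice.) Let $B$ be a set that carries a hereditarily rigid irreflexive binary relation. Then every subset $A\subseteq \mathbb{R}\times B$ admits a rigid binary relation. In particular, for every ordinal $\gamma$, every subset $A\subseteq\mathbb{R}\times\gamma$ admits a rigid binary relation.
   Context: A structure $\langle A,R\rangle$ with $R$ a binary relation on $A$ is rigid if its only automorphism is the identity, i.e. the only bijection $\pi:A\to A$ with $a\mathrel{R}b\iff\pi(a)\mathrel{R}\pi(b)$ for all $a,b\in A$ is the identity. A structure $\langle B,R_1\rangle$ is hereditarily rigid if for every subset $B'\subseteq B$ the substructure $\langle B', R_1\cap (B'\times B')\rangle$ is rigid. A relation $R_1$ on $B$ is irreflexive if $R_1(b,b)$ holds for no $b\in B$. ZF is Zermelo–Fraenkel set theory without choice. *)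

theory Defs
  imports Main "HOL-Algebra.Ring"
begin

text \<open>
  HOL itself proves the axiom of choice, so a statement about HOL sets would not express a theorem
  of ZF. Instead, E :: 'a => 'a => bool below is the membership relation of an arbitrary universe
  'a satisfying the first-order axioms of ZF (E x y reads ``x is an element of y''), and sets,
  relations, functions, reals and ordinals are always objects of that universe.
  The two axiom schemes range over first-order formulas with parameters, not over arbitrary HOL
  predicates: the latter would import the choice principle of HOL into the universe.
\<close>

datatype fm = Mem nat nat | Equal nat nat | Neg fm | Conj fm fm | Forall nat fm

primrec sat :: "('a \<Rightarrow> 'a \<Rightarrow> bool) \<Rightarrow> fm \<Rightarrow> (nat \<Rightarrow> 'a) \<Rightarrow> bool" where
  "sat E (Mem i j) v \<longleftrightarrow> E (v i) (v j)"
| "sat E (Equal i j) v \<longleftrightarrow> v i = v j"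
| "sat E (Neg \<phi>) v \<longleftrightarrow> \<not> sat E \<phi> v"
| "sat E (Conj \<phi> \<psi>) v \<longleftrightarrow> sat E \<phi> v \<and> sat E \<psi> v"
| "sat E (Forall i \<phi>) v \<longleftrightarrow> (\<forall>a. sat E \<phi> (v(i := a)))"

definition elts :: "('a \<Rightarrow> 'a \<Rightarrow> bool) \<Rightarrow> 'a \<Rightarrow> 'a set" where
  "elts E a = {x. E x a}"

definition ZF :: "('a \<Rightarrow> 'a \<Rightarrow> bool) \<Rightarrow> bool" where
  "ZF E \<longleftrightarrow>
     (\<forall>a b. elts E a = elts E b \<longrightarrow> a = b) \<and>
     (\<forall>a. elts E a \<noteq> {} \<longrightarrow> (\<exists>x \<in> elts E a. elts E x \<inter> elts E a = {})) \<and>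
     (\<forall>a b. \<exists>c. elts E c = {a, b}) \<and>
     (\<forall>a. \<exists>u. elts E u = (\<Union>x \<in> elts E a. elts E x)) \<and>
     (\<forall>a. \<exists>p. elts E p = {x. elts E x \<subseteq> elts E a}) \<and>
     (\<exists>w. (\<exists>z \<in> elts E w. elts E z = {}) \<and>
          (\<forall>x \<in> elts E w. \<exists>y \<in> elts E w. elts E y = insert x (elts E x))) \<and>
     \<comment> \<open>the valuation supplies the parameters of the scheme\<close>
     (\<forall>\<phi> v a. \<exists>b. elts E b = {x \<in> elts E a. sat E \<phi> (v(0 := x))}) \<and>
     (\<forall>\<phi> v a. (\<forall>x \<in> elts E a. \<exists>!y. sat E \<phi> (v(0 := x, 1 := y))) \<longrightarrow>
        (\<exists>b. elts E b = {y. \<exists>x \<in> elts E a. sat E \<phi> (v(0 := x, 1 := y))}))"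

definition opair :: "('a \<Rightarrow> 'a \<Rightarrow> bool) \<Rightarrow> 'a \<Rightarrow> 'a \<Rightarrow> 'a" where
  "opair E x y =
     (THE p. \<exists>s t. elts E s = {x} \<and> elts E t = {x, y} \<and> elts E p = {s, t})"

definition cross :: "('a \<Rightarrow> 'a \<Rightarrow> bool) \<Rightarrow> 'a \<Rightarrow> 'a \<Rightarrow> 'a set" where
  "cross E X Y = {opair E x y | x y. x \<in> elts E X \<and> y \<in> elts E Y}"

definition related :: "('a \<Rightarrow> 'a \<Rightarrow> bool) \<Rightarrow> 'a \<Rightarrow> 'a \<Rightarrow> 'a \<Rightarrow> bool" where
  "related E r x y \<longleftrightarrow> opair E x y \<in> elts E r"

definition relation_on :: "('a \<Rightarrow> 'a \<Rightarrow> bool) \<Rightarrow> 'a \<Rightarrow> 'a \<Rightarrow> bool" where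
  "relation_on E r A \<longleftrightarrow> elts E r \<subseteq> cross E A A"

definition is_function :: "('a \<Rightarrow> 'a \<Rightarrow> bool) \<Rightarrow> 'a \<Rightarrow> 'a \<Rightarrow> 'a \<Rightarrow> bool" where
  "is_function E f X Y \<longleftrightarrow>
     elts E f \<subseteq> cross E X Y \<and> (\<forall>x \<in> elts E X. \<exists>!y. related E f x y)"

definition app :: "('a \<Rightarrow> 'a \<Rightarrow> bool) \<Rightarrow> 'a \<Rightarrow> 'a \<Rightarrow> 'a" where
  "app E f x = (THE y. related E f x y)"

definition bijection :: "('a \<Rightarrow> 'a \<Rightarrow> bool) \<Rightarrow> 'a \<Rightarrow> 'a \<Rightarrow> 'a \<Rightarrow> bool" where
  "bijection E f X Y \<longleftrightarrow> is_function E f X Y \<and> bij_betw (app E f) (elts E X) (elts E Y)"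

definition automorphism :: "('a \<Rightarrow> 'a \<Rightarrow> bool) \<Rightarrow> 'a \<Rightarrow> 'a \<Rightarrow> 'a \<Rightarrow> bool" where
  "automorphism E \<pi> A r \<longleftrightarrow> bijection E \<pi> A A \<and>
     (\<forall>a \<in> elts E A. \<forall>b \<in> elts E A.
        related E r a b \<longleftrightarrow> related E r (app E \<pi> a) (app E \<pi> b))"

definition rigid :: "('a \<Rightarrow> 'a \<Rightarrow> bool) \<Rightarrow> 'a \<Rightarrow> 'a \<Rightarrow> bool" where
  "rigid E A r \<longleftrightarrow> (\<forall>\<pi>. automorphism E \<pi> A r \<longrightarrow> (\<forall>a \<in> elts E A. app E \<pi> a = a))"

definition hereditarily_rigid :: "('a \<Rightarrow> 'a \<Rightarrow> bool) \<Rightarrow> 'a \<Rightarrow> 'a \<Rightarrow> bool" where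
  "hereditarily_rigid E B r \<longleftrightarrow>
     (\<forall>B' r'. elts E B' \<subseteq> elts E B \<and> elts E r' = elts E r \<inter> cross E B' B' \<longrightarrow> rigid E B' r')"

definition irreflexive :: "('a \<Rightarrow> 'a \<Rightarrow> bool) \<Rightarrow> 'a \<Rightarrow> 'a \<Rightarrow> bool" where
  "irreflexive E B r \<longleftrightarrow> (\<forall>b \<in> elts E B. \<not> related E r b b)"

definition admits_rigid_relation :: "('a \<Rightarrow> 'a \<Rightarrow> bool) \<Rightarrow> 'a \<Rightarrow> bool" where
  "admits_rigid_relation E A \<longleftrightarrow> (\<exists>r. relation_on E r A \<and> rigid E A r)"

definition ordinal :: "('a \<Rightarrow> 'a \<Rightarrow> bool) \<Rightarrow> 'a \<Rightarrow> bool" where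
  "ordinal E \<gamma> \<longleftrightarrow>
     (\<forall>x \<in> elts E \<gamma>. elts E x \<subseteq> elts E \<gamma>) \<and>
     (\<forall>x \<in> elts E \<gamma>. \<not> E x x) \<and>
     (\<forall>x \<in> elts E \<gamma>. \<forall>y \<in> elts E \<gamma>. \<forall>z \<in> elts E \<gamma>. E x y \<and> E y z \<longrightarrow> E x z) \<and>
     (\<forall>x \<in> elts E \<gamma>. \<forall>y \<in> elts E \<gamma>. E x y \<or> x = y \<or> E y x) \<and>
     (\<forall>s. elts E s \<subseteq> elts E \<gamma> \<and> elts E s \<noteq> {} \<longrightarrow>
        (\<exists>m \<in> elts E s. \<forall>y \<in> elts E s. m = y \<or> E m y))"

definition binary_operation :: "('a \<Rightarrow> 'a \<Rightarrow> bool) \<Rightarrow> 'a \<Rightarrow> 'a \<Rightarrow> bool" where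
  "binary_operation E f X \<longleftrightarrow> (\<exists>D. elts E D = cross E X X \<and> is_function E f D X)"

definition app2 :: "('a \<Rightarrow> 'a \<Rightarrow> bool) \<Rightarrow> 'a \<Rightarrow> 'a \<Rightarrow> 'a \<Rightarrow> 'a" where
  "app2 E f x y = app E f (opair E x y)"

definition ring_of :: "('a \<Rightarrow> 'a \<Rightarrow> bool) \<Rightarrow> 'a \<Rightarrow> 'a \<Rightarrow> 'a \<Rightarrow> 'a \<Rightarrow> 'a \<Rightarrow> 'a ring" where
  "ring_of E R pl tm z e =
     \<lparr>carrier = elts E R, monoid.mult = app2 E tm, one = e, zero = z, add = app2 E pl\<rparr>"

text \<open>
  The real line of the universe is its complete ordered field, which ZF proves to exist and to be
  unique up to isomorphism. Completeness refers to the sets of reals of the universe only.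
\<close>

definition real_field ::
  "('a \<Rightarrow> 'a \<Rightarrow> bool) \<Rightarrow> 'a \<Rightarrow> 'a \<Rightarrow> 'a \<Rightarrow> 'a \<Rightarrow> 'a \<Rightarrow> 'a \<Rightarrow> bool" where
  "real_field E R pl tm z e lt \<longleftrightarrow>
     binary_operation E pl R \<and> binary_operation E tm R \<and> relation_on E lt R \<and>
     field (ring_of E R pl tm z e) \<and>
     (\<forall>x \<in> elts E R. \<not> related E lt x x) \<and>
     (\<forall>x \<in> elts E R. \<forall>y \<in> elts E R. \<forall>w \<in> elts E R.
        related E lt x y \<and> related E lt y w \<longrightarrow> related E lt x w) \<and>
     (\<forall>x \<in> elts E R. \<forall>y \<in> elts E R. related E lt x y \<or> x = y \<or> related E lt y x) \<and>
     (\<forall>x \<in> elts E R. \<forall>y \<in> elts E R. \<forall>w \<in> elts E R.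
        related E lt x y \<longrightarrow> related E lt (app2 E pl x w) (app2 E pl y w)) \<and>
     (\<forall>x \<in> elts E R. \<forall>y \<in> elts E R.
        related E lt z x \<and> related E lt z y \<longrightarrow> related E lt z (app2 E tm x y)) \<and>
     (\<forall>S. elts E S \<subseteq> elts E R \<and> elts E S \<noteq> {} \<and>
        (\<exists>u \<in> elts E R. \<forall>x \<in> elts E S. \<not> related E lt u x) \<longrightarrow>
        (\<exists>s \<in> elts E R. (\<forall>x \<in> elts E S. \<not> related E lt s x) \<and>
           (\<forall>u \<in> elts E R. (\<forall>x \<in> elts E S. \<not> related E lt u x) \<longrightarrow> \<not> related E lt u s)))"

end

theory Submission
  imports Defs
begin

text \<open>
  Call a subset of \<open>A\<close> a progression if it is a copy of the natural numbers, with a successor map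
  in the universe. If \<open>A\<close> contains a progression \<open>Z\<close>, relate each element of \<open>Z\<close> to its successor,
  relate \<open>n \<in> Z\<close> to \<open>(x, b) \<notin> Z\<close> if \<open>n\<close> belongs to the subset of \<open>Z\<close> that codes the real \<open>x\<close>, and
  put the reflexive closure of \<open>R\<^sub>1\<close> on every fibre outside \<open>Z\<close>. The loops tell \<open>Z\<close> from its
  complement, so an automorphism fixes \<open>Z\<close> pointwise, hence preserves first coordinates, hence is
  the identity because the fibres are rigid. If \<open>A\<close> contains no progression, order \<open>A\<close>
  lexicographically: the orbit of an element whose first coordinate is moved by an automorphism
  would be a progression, so that automorphisms again act within the fibres.

  The code of a real is its binary expansion, obtained as the itinerary of a point of \<open>[-1, 1]\<close> under
  the doubling map. Sets of the universe are formed by separation only, so every predicate involved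
  has to be definable by a first-order formula with parameters.
\<close>

section \<open>Definability with parameters\<close>

primrec vars :: "fm \<Rightarrow> nat set" where
  "vars (Mem i j) = {i, j}"
| "vars (Equal i j) = {i, j}"
| "vars (Neg \<phi>) = vars \<phi>"
| "vars (Conj \<phi> \<psi>) = vars \<phi> \<union> vars \<psi>"
| "vars (Forall i \<phi>) = insert i (vars \<phi>)"

primrec rename :: "(nat \<Rightarrow> nat) \<Rightarrow> fm \<Rightarrow> fm" where
  "rename \<rho> (Mem i j) = Mem (\<rho> i) (\<rho> j)"
| "rename \<rho> (Equal i j) = Equal (\<rho> i) (\<rho> j)"
| "rename \<rho> (Neg \<phi>) = Neg (rename \<rho> \<phi>)"
| "rename \<rho> (Conj \<phi> \<psi>) = Conj (rename \<rho> \<phi>) (rename \<rho> \<psi>)"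
| "rename \<rho> (Forall i \<phi>) = Forall (\<rho> i) (rename \<rho> \<phi>)"

section \<open>Variables and their renaming\<close>

lemma finite_vars: "finite (vars \<phi>)"
  by (induction \<phi>) auto

lemma sat_cong: "(\<And>i. i \<in> vars \<phi> \<Longrightarrow> v i = w i) \<Longrightarrow> sat E \<phi> v \<longleftrightarrow> sat E \<phi> w"
proof (induction \<phi> arbitrary: v w)
  case (Forall i \<phi>)
  have "sat E \<phi> (v(i := a)) \<longleftrightarrow> sat E \<phi> (w(i := a))" for a
    using Forall.prems by (intro Forall.IH) auto
  then show ?case by simp
next
  case (Neg \<phi>)
  then show ?case by (metis sat.simps(3) vars.simps(3))
next
  case (Conj \<phi> \<psi>)
  have "sat E \<phi> v \<longleftrightarrow> sat E \<phi> w" "sat E \<psi> v \<longleftrightarrow> sat E \<psi> w"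
    using Conj.prems by (auto intro!: Conj.IH)
  then show ?case by simp
qed auto

text \<open>Injectivity on all variables, bound ones included, is what rules out capture.\<close>

lemma sat_rename:
  "inj_on \<rho> (vars \<phi>) \<Longrightarrow> sat E (rename \<rho> \<phi>) v \<longleftrightarrow> sat E \<phi> (\<lambda>i. v (\<rho> i))"
proof (induction \<phi> arbitrary: v)
  case (Forall i \<phi>)
  have "sat E (rename \<rho> \<phi>) (v(\<rho> i := a)) \<longleftrightarrow> sat E \<phi> ((\<lambda>i. v (\<rho> i))(i := a))" for a
  proof -
    have "sat E (rename \<rho> \<phi>) (v(\<rho> i := a)) \<longleftrightarrow> sat E \<phi> (\<lambda>j. (v(\<rho> i := a)) (\<rho> j))"
      using Forall.prems by (intro Forall.IH) (auto simp: inj_on_def)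
    also have "\<dots> \<longleftrightarrow> sat E \<phi> ((\<lambda>i. v (\<rho> i))(i := a))"
      using Forall.prems by (intro sat_cong) (auto simp: inj_on_def)
    finally show ?thesis .
  qed
  then show ?case by simp
next
  case (Conj \<phi> \<psi>)
  then show ?case by (simp add: inj_on_Un)
qed auto

text \<open>Even positions hold the free variables and odd positions the parameters, so that both
  supplies are infinite.\<close>

definition mix :: "(nat \<Rightarrow> 'a) \<Rightarrow> (nat \<Rightarrow> 'a) \<Rightarrow> nat \<Rightarrow> 'a" where
  "mix w v i = (if even i then v (i div 2) else w (i div 2))"

lemma mix_simps [simp]: "mix w v (2 * i) = v i" "mix w v (Suc (2 * i)) = w i"
  by (simp_all add: mix_def)

text \<open>One formula and one list \<open>w\<close> of parameters must serve all values of the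
  free variables. These are the predicates to which separation will be applied.\<close>

definition definable :: "('a \<Rightarrow> 'a \<Rightarrow> bool) \<Rightarrow> ((nat \<Rightarrow> 'a) \<Rightarrow> bool) \<Rightarrow> bool" where
  "definable E P \<longleftrightarrow> (\<exists>\<phi> w. \<forall>v. P v \<longleftrightarrow> sat E \<phi> (mix w v))"

text \<open>Binders are handled in de Bruijn style: the value of a function, like the witness of a
  quantifier, is variable 0, and the remaining variables are shifted by one.\<close>

definition definable_fun :: "('a \<Rightarrow> 'a \<Rightarrow> bool) \<Rightarrow> ((nat \<Rightarrow> 'a) \<Rightarrow> 'a) \<Rightarrow> bool" where
  "definable_fun E t \<longleftrightarrow> definable E (\<lambda>v. v 0 = t (\<lambda>i. v (Suc i)))"

lemma definable_shift:
  assumes "definable E P" and "inj \<rho>"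
  shows "definable E (\<lambda>v. P (\<lambda>i. v (\<rho> i)))"
proof -
  obtain \<phi> w where \<phi>: "\<And>v. P v \<longleftrightarrow> sat E \<phi> (mix w v)"
    using assms(1) unfolding definable_def by blast
  \<comment> \<open>Only the even positions are reindexed; the parameters stay in place.\<close>
  define \<sigma> where "\<sigma> i = (if even i then 2 * \<rho> (i div 2) else i)" for i
  have "inj \<sigma>"
  proof (rule injI)
    fix i j assume "\<sigma> i = \<sigma> j"
    moreover have "\<rho> (i div 2) = \<rho> (j div 2) \<Longrightarrow> i div 2 = j div 2"
      using assms(2) by (simp add: inj_eq)
    ultimately show "i = j"
      unfolding \<sigma>_def by (smt (verit) dvd_triv_left even_two_times_div_two mult_cancel_left numeral_neq_zero)
  qed
  have "(\<lambda>i. mix w v (\<sigma> i)) = mix w (\<lambda>i. v (\<rho> i))" for v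
    by (auto simp: mix_def \<sigma>_def)
  then have "P (\<lambda>i. v (\<rho> i)) \<longleftrightarrow> sat E (rename \<sigma> \<phi>) (mix w v)" for v
    using \<phi> sat_rename[of \<sigma> \<phi> E "mix w v"] \<open>inj \<sigma>\<close> by (simp add: inj_on_subset)
  then show ?thesis unfolding definable_def by blast
qed

section \<open>Closure under connectives and quantifiers\<close>

lemma definable_not: "definable E P \<Longrightarrow> definable E (\<lambda>v. \<not> P v)"
  unfolding definable_def by (metis sat.simps(3))

lemma definable_conj:
  assumes "definable E P" and "definable E Q"
  shows "definable E (\<lambda>v. P v \<and> Q v)"
proof -
  obtain \<phi> w where \<phi>: "\<And>v. P v \<longleftrightarrow> sat E \<phi> (mix w v)"
    using assms(1) unfolding definable_def by blast
  obtain \<psi> u where \<psi>: "\<And>v. Q v \<longleftrightarrow> sat E \<psi> (mix u v)"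
    using assms(2) unfolding definable_def by blast
  \<comment> \<open>The two parameter lists are interleaved in \<open>mix u w\<close>: those of
    \<open>\<phi>\<close> move to its even places, those of \<open>\<psi>\<close> to its odd
    ones.\<close>
  define \<sigma> :: "nat \<Rightarrow> nat" where "\<sigma> i = (if even i then i else Suc (2 * (2 * (i div 2))))" for i
  define \<tau> :: "nat \<Rightarrow> nat" where "\<tau> i = (if even i then i else Suc (2 * Suc (2 * (i div 2))))" for i
  have inj: "inj \<sigma>" "inj \<tau>"
    by (rule inj_on_inverseI[where g = "\<lambda>i. if even i then i else Suc (2 * (i div 2 div 2))"];
        simp add: \<sigma>_def \<tau>_def)+
  have mix: "(\<lambda>i. mix (mix u w) v (\<sigma> i)) = mix w v" "(\<lambda>i. mix (mix u w) v (\<tau> i)) = mix u v" for v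
  proof -
    have "mix (mix u w) v (\<sigma> i) = mix w v i \<and> mix (mix u w) v (\<tau> i) = mix u v i" for i
    proof (cases "even i")
      case True
      then show ?thesis by (simp add: \<sigma>_def \<tau>_def mix_def)
    next
      case False
      have "mix (mix u w) v (Suc (2 * (2 * (i div 2)))) = w (i div 2)"
        "mix (mix u w) v (Suc (2 * Suc (2 * (i div 2)))) = u (i div 2)"
        by (simp_all only: mix_simps)
      then show ?thesis
        using False unfolding \<sigma>_def \<tau>_def mix_def[of w v i] mix_def[of u v i] by (simp only: if_False)
    qed
    then show "(\<lambda>i. mix (mix u w) v (\<sigma> i)) = mix w v" "(\<lambda>i. mix (mix u w) v (\<tau> i)) = mix u v"
      by blast+
  qed
  have "P v \<and> Q v \<longleftrightarrow> sat E (Conj (rename \<sigma> \<phi>) (rename \<tau> \<psi>)) (mix (mix u w) v)" for v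
    using sat_rename[OF inj_on_subset[OF inj(1) subset_UNIV], of E \<phi> "mix (mix u w) v"]
      sat_rename[OF inj_on_subset[OF inj(2) subset_UNIV], of E \<psi> "mix (mix u w) v"]
    by (simp add: mix \<phi> \<psi>)
  then show ?thesis unfolding definable_def by blast
qed

lemma definable_all:
  assumes "definable E (\<lambda>v. Q (v 0) (\<lambda>i. v (Suc i)))"
  shows "definable E (\<lambda>v. \<forall>a. Q a v)"
proof -
  obtain \<phi> w where \<phi>: "\<And>v. Q (v 0) (\<lambda>i. v (Suc i)) \<longleftrightarrow> sat E \<phi> (mix w v)"
    using assms unfolding definable_def by blast
  obtain K where K: "\<And>i. i \<in> vars \<phi> \<Longrightarrow> i < K"
    using finite_vars[of \<phi>] by (meson finite_nat_set_iff_bounded)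
  \<comment> \<open>Variable 0 is to be bound and goes to \<open>2 * K\<close>, beyond the images of
    all other positions in \<open>\<phi>\<close>; the remaining free variables move down by one
    place.\<close>
  define \<sigma> where "\<sigma> i = (if i = 0 then 2 * K else if even i then i - 2 else i)" for i
  have inj: "inj_on \<sigma> (vars \<phi>)"
    by (rule inj_on_inverseI[where g = "\<lambda>i. if i = 2 * K then 0 else if even i then i + 2 else i"])
      (auto simp: \<sigma>_def dest!: K)
  have eq: "sat E (rename \<sigma> \<phi>) ((mix w v)(2 * K := a)) \<longleftrightarrow> Q a v" for a v
  proof -
    have "sat E (rename \<sigma> \<phi>) ((mix w v)(2 * K := a)) \<longleftrightarrow>
        sat E \<phi> (\<lambda>i. ((mix w v)(2 * K := a)) (\<sigma> i))"
      using inj by (rule sat_rename)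
    also have "\<dots> \<longleftrightarrow> sat E \<phi> (mix w (case_nat a v))"
    proof (rule sat_cong)
      fix i assume "i \<in> vars \<phi>"
      then have "i < K" by (rule K)
      show "((mix w v)(2 * K := a)) (\<sigma> i) = mix w (case_nat a v) i"
      proof (cases "even i")
        case True
        then obtain j where "i = 2 * j" by (elim evenE)
        then show ?thesis
          using \<open>i < K\<close> by (cases j) (auto simp: \<sigma>_def mix_def)
      next
        case False
        then show ?thesis
          using \<open>i < K\<close> by (auto simp: \<sigma>_def mix_def)
      qed
    qed
    also have "\<dots> \<longleftrightarrow> Q a v"
      using \<phi>[of "case_nat a v"] by simp
    finally show ?thesis .
  qed
  show ?thesis
    unfolding definable_def
    by (rule exI[of _ "Forall (2 * K) (rename \<sigma> \<phi>)"], rule exI[of _ w]) (simp add: eq)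
qed

lemma definable_ex:
  assumes "definable E (\<lambda>v. Q (v 0) (\<lambda>i. v (Suc i)))"
  shows "definable E (\<lambda>v. \<exists>a. Q a v)"
proof -
  have "definable E (\<lambda>v. \<not> (\<forall>a. \<not> Q a v))"
    by (intro definable_not definable_all assms)
  then show ?thesis by simp
qed

lemma definable_disj:
  assumes "definable E P" and "definable E Q"
  shows "definable E (\<lambda>v. P v \<or> Q v)"
proof -
  have "definable E (\<lambda>v. \<not> (\<not> P v \<and> \<not> Q v))"
    by (intro definable_not definable_conj assms)
  then show ?thesis by simp
qed

lemma definable_imp:
  assumes "definable E P" and "definable E Q"
  shows "definable E (\<lambda>v. P v \<longrightarrow> Q v)"
  unfolding imp_conv_disj by (intro definable_not definable_disj assms)

lemma definable_iff:
  assumes "definable E P" and "definable E Q"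
  shows "definable E (\<lambda>v. P v \<longleftrightarrow> Q v)"
  unfolding iff_conv_conj_imp by (intro definable_imp definable_conj assms)

text \<open>The term is replaced by a bound variable required to equal it, so a definable graph is
  all that is asked of \<open>t\<close>.\<close>

lemma definable_subst:
  assumes "definable_fun E t" and "definable E (\<lambda>v. Q (v 0) (\<lambda>i. v (Suc i)))"
  shows "definable E (\<lambda>v. Q (t v) v)"
proof -
  have "definable E (\<lambda>v. \<exists>a. a = t v \<and> Q a v)"
    using assms unfolding definable_fun_def by (intro definable_ex definable_conj)
  then show ?thesis by simp
qed

lemma definable_fun_shift:
  assumes "definable_fun E t"
  shows "definable_fun E (\<lambda>v. t (\<lambda>i. v (Suc i)))"
proof -
  have "inj (\<lambda>i. if i = 0 then 0 else Suc i)"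
    by (auto simp: inj_def)
  from definable_shift[OF assms[unfolded definable_fun_def] this] show ?thesis
    unfolding definable_fun_def by simp
qed

lemma definable_subst2:
  assumes "definable_fun E s" and "definable_fun E t"
    and "definable E (\<lambda>v. Q (v 0) (v (Suc 0)))"
  shows "definable E (\<lambda>v. Q (s v) (t v))"
proof -
  \<comment> \<open>\<open>definable_subst\<close> acts on variable 0 only, so the arguments are
    swapped, \<open>t\<close> is substituted first and \<open>s\<close> second.\<close>
  have "inj (\<lambda>i. if i = 0 then 1 else if i = Suc 0 then 0 else i)"
    by (auto simp: inj_def)
  from definable_shift[OF assms(3) this]
  have "definable E (\<lambda>v. Q (v (Suc 0)) (v 0))" by simp
  then have "definable E (\<lambda>v. Q (v 0) (t (\<lambda>i. v (Suc i))))"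
    by (intro definable_subst[OF definable_fun_shift[OF assms(2)], where Q = "\<lambda>b v. Q (v 0) b"])
  then show ?thesis
    by (rule definable_subst[OF assms(1), where Q = "\<lambda>a v. Q a (t v)"])
qed

lemma definable_atoms:
  "definable E (\<lambda>v. E (v i) (v j))" "definable E (\<lambda>v. v i = v j)" "definable E (\<lambda>v. v i = c)"
proof -
  show "definable E (\<lambda>v. E (v i) (v j))"
    unfolding definable_def by (rule exI[of _ "Mem (2 * i) (2 * j)"]) simp
  show "definable E (\<lambda>v. v i = v j)"
    unfolding definable_def by (rule exI[of _ "Equal (2 * i) (2 * j)"]) simp
  show "definable E (\<lambda>v. v i = c)"
    unfolding definable_def
    by (rule exI[of _ "Equal (2 * i) (Suc (2 * 0))"], rule exI[of _ "\<lambda>_. c"]) (simp add: mix_def)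
qed

lemma definable_fun_var: "definable_fun E (\<lambda>v. v i)"
  unfolding definable_fun_def by (rule definable_atoms)

lemma definable_fun_const: "definable_fun E (\<lambda>v. c)"
  unfolding definable_fun_def by (rule definable_atoms)

lemma definable_mem:
  "definable_fun E s \<Longrightarrow> definable_fun E t \<Longrightarrow> definable E (\<lambda>v. E (s v) (t v))"
  using definable_subst2[where Q = E] definable_atoms(1) by blast

lemma definable_eq:
  "definable_fun E s \<Longrightarrow> definable_fun E t \<Longrightarrow> definable E (\<lambda>v. s v = t v)"
  using definable_subst2[where Q = "(=)"] definable_atoms(2) by blast

lemma definable_in_elts:
  "definable_fun E s \<Longrightarrow> definable_fun E t \<Longrightarrow> definable E (\<lambda>v. s v \<in> elts E (t v))"
  unfolding elts_def by (simp add: definable_mem)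

text \<open>The truth value does not depend on \<open>v\<close>, so a trivially true or false
  formula serves, however complicated \<open>P\<close> is as a statement of HOL.\<close>

lemma definable_const: "definable E (\<lambda>v. P)"
proof (cases P)
  case True
  have "definable E (\<lambda>v. v 0 = v 0)" by (rule definable_atoms)
  then show ?thesis using True by simp
next
  case False
  have "definable E (\<lambda>v. \<not> v 0 = v 0)" by (intro definable_not definable_atoms)
  then show ?thesis using False by simp
qed

lemma definable_bex:
  assumes "definable_fun E t" "definable E (\<lambda>v. Q (v 0) (\<lambda>i. v (Suc i)))"
  shows "definable E (\<lambda>v. \<exists>a \<in> elts E (t v). Q a v)"
  unfolding Bex_def
  by (intro definable_ex definable_conj definable_in_elts definable_fun_var
      definable_fun_shift[OF assms(1)] assms(2))

lemma definable_ball: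
  assumes "definable_fun E t" "definable E (\<lambda>v. Q (v 0) (\<lambda>i. v (Suc i)))"
  shows "definable E (\<lambda>v. \<forall>a \<in> elts E (t v). Q a v)"
  unfolding Ball_def
  by (intro definable_all definable_imp definable_in_elts definable_fun_var
      definable_fun_shift[OF assms(1)] assms(2))

lemma definable_fun_if:
  assumes "definable E P" "definable_fun E s" "definable_fun E t"
  shows "definable_fun E (\<lambda>v. if P v then s v else t v)"
proof -
  have "definable E (\<lambda>v. P (\<lambda>i. v (Suc i)) \<and> v 0 = s (\<lambda>i. v (Suc i)) \<or>
      \<not> P (\<lambda>i. v (Suc i)) \<and> v 0 = t (\<lambda>i. v (Suc i)))"
    by (intro definable_disj definable_conj definable_not definable_eq definable_fun_var
        definable_fun_shift[OF assms(2)] definable_fun_shift[OF assms(3)]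
        definable_shift[OF assms(1) inj_Suc])
  then show ?thesis
    unfolding definable_fun_def by (rule back_subst[of "definable E"]) auto
qed

lemma definable_fun_comp:
  assumes "definable_fun E (\<lambda>v. f (v 0))" and "definable_fun E t"
  shows "definable_fun E (\<lambda>v. f (t v))"
  unfolding definable_fun_def
  by (rule definable_subst2[where Q = "\<lambda>y x. y = f x"])
    (rule definable_fun_var definable_fun_shift[OF assms(2)] assms(1)[unfolded definable_fun_def])+

lemmas definable_intros = definable_not definable_conj definable_all definable_ex definable_disj
  definable_imp definable_iff definable_fun_var definable_fun_const definable_mem definable_eq
  definable_in_elts definable_const definable_bex definable_ball definable_fun_if

section \<open>Sets in a model of ZF\<close>

locale zf =
  fixes E :: "'a \<Rightarrow> 'a \<Rightarrow> bool"
  assumes ZF: "ZF E"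
begin

lemma extensionality: "elts E a = elts E b \<Longrightarrow> a = b"
  using ZF[unfolded ZF_def, THEN conjunct1] by blast

lemmas ZF_sets = ZF[unfolded ZF_def, THEN conjunct2, THEN conjunct2]

lemma pairing: "\<exists>c. elts E c = {a, b}"
  using ZF_sets[THEN conjunct1, rule_format] by blast

lemma union: "\<exists>u. elts E u = (\<Union>x \<in> elts E a. elts E x)"
  using ZF_sets[THEN conjunct2, THEN conjunct1, rule_format] by blast

lemma power_set: "\<exists>p. elts E p = {x. elts E x \<subseteq> elts E a}"
  using ZF_sets[THEN conjunct2, THEN conjunct2, THEN conjunct1, rule_format] by blast

lemma separation:
  assumes "definable E (\<lambda>v. P (v 0))"
  shows "\<exists>b. elts E b = {x \<in> elts E a. P x}"
proof -
  obtain \<phi> w where \<phi>: "\<And>v. P (v 0) \<longleftrightarrow> sat E \<phi> (mix w v)"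
    using assms unfolding definable_def by blast
  \<comment> \<open>The scheme varies position 0, which is free variable 0, the one that
    \<open>P\<close> looks at; the second \<open>w\<close> fills the other even places with
    arbitrary values.\<close>
  have "\<exists>b. elts E b = {x \<in> elts E a. sat E \<phi> ((mix w w)(0 := x))}"
    using ZF_sets[THEN conjunct2, THEN conjunct2, THEN conjunct2, THEN conjunct2, THEN conjunct1,
        rule_format] .
  moreover have "sat E \<phi> ((mix w w)(0 := x)) \<longleftrightarrow> P x" for x
  proof -
    have "(mix w w)(0 := x) = mix w (w(0 := x))"
      by (auto simp: mix_def fun_eq_iff elim!: evenE)
    then show ?thesis using \<phi>[of "w(0 := x)"] by simp
  qed
  ultimately show ?thesis by simp
qed

text \<open>Pairing gives existence and extensionality uniqueness, which trades the description in
  \<open>opair\<close> for a first-order condition.\<close>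

lemma opair_iff:
  "p = opair E x y \<longleftrightarrow> (\<exists>s t. elts E s = {x} \<and> elts E t = {x, y} \<and> elts E p = {s, t})"
    (is "_ \<longleftrightarrow> ?Q p")
proof -
  obtain s t q where q: "elts E s = {x}" "elts E t = {x, y}" "elts E q = {s, t}"
    using pairing[of x x] pairing[of x y] pairing by (metis insert_absorb2)
  have unique: "p = q" if "?Q p" for p
  proof -
    obtain s' t' where "elts E s' = {x}" "elts E t' = {x, y}" "elts E p = {s', t'}"
      using \<open>?Q p\<close> by blast
    moreover have "s' = s" "t' = t"
      by (rule extensionality, simp add: calculation q)+
    ultimately show ?thesis using q by (intro extensionality) simp
  qed
  have "?Q q" using q by blast
  moreover from this have "opair E x y = q"
    unfolding opair_def using unique by (rule the_equality)
  ultimately show ?thesis by (intro iffI) (simp_all only: unique)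
qed

lemma opair_inject [simp]: "opair E x y = opair E x' y' \<longleftrightarrow> x = x' \<and> y = y'"
proof
  assume "opair E x y = opair E x' y'"
  then obtain s t s' t' where "elts E s = {x}" "elts E t = {x, y}" "elts E s' = {x'}"
    "elts E t' = {x', y'}" "{s, t} = {s', t'}"
    using opair_iff[of "opair E x y" x y] opair_iff[of "opair E x' y'" x' y'] by metis
  then have "{x} = {x'} \<and> {x, y} = {x', y'} \<or> {x} = {x', y'} \<and> {x, y} = {x'}"
    unfolding doubleton_eq_iff[of s] by metis
  then show "x = x' \<and> y = y'"
    by (auto simp: doubleton_eq_iff)
qed simp

lemma elts_eq_pair_iff: "elts E s = {x, y} \<longleftrightarrow> (\<forall>w. E w s \<longleftrightarrow> w = x \<or> w = y)"
  unfolding elts_def by blast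

lemma definable_fun_opair:
  assumes "definable_fun E s" and "definable_fun E t"
  shows "definable_fun E (\<lambda>v. opair E (s v) (t v))"
proof -
  \<comment> \<open>The singleton is written as a doubleton of equal elements, so that one
    equivalence unfolds all three sets.\<close>
  have "definable E (\<lambda>v. \<exists>c d. (\<forall>w. E w c \<longleftrightarrow> w = s (\<lambda>i. v (Suc i)) \<or> w = s (\<lambda>i. v (Suc i))) \<and>
      (\<forall>w. E w d \<longleftrightarrow> w = s (\<lambda>i. v (Suc i)) \<or> w = t (\<lambda>i. v (Suc i))) \<and>
      (\<forall>w. E w (v 0) \<longleftrightarrow> w = c \<or> w = d))"
    \<comment> \<open>The terms are shifted once for the value and once more for each of the binders
      \<open>c\<close>, \<open>d\<close> and \<open>w\<close>.\<close>
    by (intro definable_intros assms[THEN definable_fun_shift]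
        assms[THEN definable_fun_shift, THEN definable_fun_shift]
        assms[THEN definable_fun_shift, THEN definable_fun_shift, THEN definable_fun_shift]
        assms[THEN definable_fun_shift, THEN definable_fun_shift, THEN definable_fun_shift,
          THEN definable_fun_shift])
  then show ?thesis
    unfolding definable_fun_def opair_iff
    unfolding elts_eq_pair_iff[symmetric] by simp
qed

lemma definable_related:
  assumes "definable_fun E q" "definable_fun E s" "definable_fun E t"
  shows "definable E (\<lambda>v. related E (q v) (s v) (t v))"
  unfolding related_def by (intro definable_intros definable_fun_opair assms)

lemmas def_intros = definable_intros definable_fun_opair definable_related

text \<open>A Kuratowski pair of elements of \<open>X\<close> and \<open>Y\<close> lies in the
  double power set of their union, from which separation cuts out the product.\<close>

lemma ex_product: "\<exists>D. elts E D = cross E X Y"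
proof -
  obtain c where c: "elts E c = {X, Y}" using pairing by blast
  obtain u where u: "elts E u = (\<Union>x \<in> elts E c. elts E x)" using union by blast
  obtain p where p: "elts E p = {x. elts E x \<subseteq> elts E u}" using power_set by blast
  obtain q where q: "elts E q = {x. elts E x \<subseteq> elts E p}" using power_set by blast
  have sub: "cross E X Y \<subseteq> elts E q"
  proof
    fix a assume "a \<in> cross E X Y"
    then obtain x y where "x \<in> elts E X" "y \<in> elts E Y" "a = opair E x y"
      unfolding cross_def by blast
    moreover from this obtain s t where "elts E s = {x}" "elts E t = {x, y}" "elts E a = {s, t}"
      unfolding opair_iff by blast
    ultimately show "a \<in> elts E q" using c u p q by auto
  qed
  have "\<exists>D. elts E D = {a \<in> elts E q. \<exists>x y. a = opair E x y \<and> x \<in> elts E X \<and> y \<in> elts E Y}"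
    by (intro separation def_intros)
  moreover have "{a \<in> elts E q. \<exists>x y. a = opair E x y \<and> x \<in> elts E X \<and> y \<in> elts E Y} = cross E X Y"
    using sub unfolding cross_def by blast
  ultimately show ?thesis by simp
qed

text \<open>Nearly every relation below enters the universe this way: as a definable predicate cut
  down to a product.\<close>

lemma relation_comprehension:
  assumes "definable E (\<lambda>v. W (v 0) (v (Suc 0)))"
  shows "\<exists>r. elts E r \<subseteq> cross E X Y \<and>
    (\<forall>a b. related E r a b = (a \<in> elts E X \<and> b \<in> elts E Y \<and> W a b))"
proof -
  obtain D where D: "elts E D = cross E X Y" using ex_product by blast
  have "\<exists>r. elts E r = {p \<in> elts E D. \<exists>a b. p = opair E a b \<and> W a b}"
    by (intro separation def_intros definable_subst2[where Q = W, OF _ _ assms])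
  then obtain r where r: "elts E r = {p \<in> elts E D. \<exists>a b. p = opair E a b \<and> W a b}"
    by blast
  have "related E r a b \<longleftrightarrow> a \<in> elts E X \<and> b \<in> elts E Y \<and> W a b" for a b
    unfolding related_def r D cross_def by auto
  then show ?thesis using r D by auto
qed

lemma opair_in_cross [simp]: "opair E x y \<in> cross E X Y \<longleftrightarrow> x \<in> elts E X \<and> y \<in> elts E Y"
  unfolding cross_def by auto

subsection \<open>Functions and automorphisms\<close>

text \<open>A variant of application without junk values: those of the unspecified \<^const>\<open>The\<close>
  in \<^const>\<open>app\<close> need not be definable.\<close>

definition fapp :: "'a \<Rightarrow> 'a \<Rightarrow> 'a" where
  "fapp f x = (if \<exists>!y. related E f x y then app E f x else x)"

lemma definable_fun_fapp:
  assumes "definable_fun E s" and "definable_fun E t"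
  shows "definable_fun E (\<lambda>v. fapp (s v) (t v))"
proof -
  \<comment> \<open>With unique existence written out by quantifiers, both cases of
    \<open>fapp\<close> become first-order.\<close>
  have "y = fapp f x \<longleftrightarrow> (\<exists>y. related E f x y \<and> (\<forall>w. related E f x w \<longrightarrow> w = y)) \<and> related E f x y \<or>
      \<not> (\<exists>y. related E f x y \<and> (\<forall>w. related E f x w \<longrightarrow> w = y)) \<and> y = x" for f x y
    unfolding fapp_def app_def Ex1_def[symmetric] by (auto intro: the1_equality[symmetric] theI')
  then show ?thesis
    unfolding definable_fun_def
    by (simp only:) (intro def_intros assms[THEN definable_fun_shift]
        assms[THEN definable_fun_shift, THEN definable_fun_shift]
        assms[THEN definable_fun_shift, THEN definable_fun_shift, THEN definable_fun_shift])
qed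

lemma fapp_eq_app: "is_function E f X Y \<Longrightarrow> x \<in> elts E X \<Longrightarrow> fapp f x = app E f x"
  unfolding fapp_def is_function_def by simp

lemma related_iff_app:
  assumes "is_function E f X Y" "x \<in> elts E X"
  shows "related E f x y \<longleftrightarrow> y = app E f x"
  using assms unfolding is_function_def app_def by (metis the1_equality theI')

lemma app_in:
  assumes "is_function E f X Y" "x \<in> elts E X"
  shows "app E f x \<in> elts E Y"
proof -
  have "related E f x (app E f x)" using related_iff_app[OF assms] by simp
  then show ?thesis
    using assms(1) unfolding is_function_def related_def by auto
qed

text \<open>A bijection of HOL need not be an object of the universe; a definable graph makes it
  one, so that rigidity can be applied to it.\<close>

lemma ex_bijection:
  assumes def: "definable E (\<lambda>v. W (v 0) (v (Suc 0)))"
    and graph: "\<And>x y. x \<in> elts E X \<Longrightarrow> y \<in> elts E Y \<Longrightarrow> W x y \<longleftrightarrow> y = g x"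
    and bij: "bij_betw g (elts E X) (elts E Y)"
  shows "\<exists>f. bijection E f X Y \<and> (\<forall>x \<in> elts E X. app E f x = g x)"
proof -
  obtain f where f: "elts E f \<subseteq> cross E X Y"
    "\<forall>a b. related E f a b = (a \<in> elts E X \<and> b \<in> elts E Y \<and> W a b)"
    using relation_comprehension[OF def, of X Y] by (elim exE conjE)
  have g: "g x \<in> elts E Y" if "x \<in> elts E X" for x
    using bij that by (auto simp: bij_betw_def)
  have rel: "related E f x y \<longleftrightarrow> y = g x" if "x \<in> elts E X" for x y
    using f(2) graph g that by blast
  then have func: "is_function E f X Y"
    using f(1) unfolding is_function_def Ex1_def by simp
  moreover have app: "app E f x = g x" if "x \<in> elts E X" for x
    using rel[OF that] related_iff_app[OF func that] by blast
  moreover have "bij_betw (app E f) (elts E X) (elts E Y)"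
    using bij app by (simp cong: bij_betw_cong)
  ultimately show ?thesis unfolding bijection_def by blast
qed

text \<open>The fibre of \<open>A\<close> over \<open>x\<close> is a subset of \<open>B\<close>, on which \<open>\<pi>\<close> induces an automorphism.\<close>

lemma fibrewise_automorphism_trivial:
  assumes A: "elts E A \<subseteq> cross E X B"
    and hered: "hereditarily_rigid E B R\<^sub>1"
    and \<pi>: "bijection E \<pi> A A"
    and first: "\<And>x b. opair E x b \<in> elts E A \<Longrightarrow> \<exists>c. app E \<pi> (opair E x b) = opair E x c"
    and D: "definable E (\<lambda>v. D (v 0))"
    and D_iff: "\<And>a. a \<in> elts E A \<Longrightarrow> D (app E \<pi> a) \<longleftrightarrow> D a"
    and pres: "\<And>x b b' c c'. opair E x b \<in> elts E A \<Longrightarrow> opair E x b' \<in> elts E A \<Longrightarrow>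
      D (opair E x b) \<Longrightarrow> D (opair E x b') \<Longrightarrow>
      app E \<pi> (opair E x b) = opair E x c \<Longrightarrow> app E \<pi> (opair E x b') = opair E x c' \<Longrightarrow>
      related E R\<^sub>1 b b' \<longleftrightarrow> related E R\<^sub>1 c c'"
    and a: "a \<in> elts E A" "D a"
  shows "app E \<pi> a = a"
proof -
  obtain x b where xb: "a = opair E x b" using a(1) A unfolding cross_def by blast
  \<comment> \<open>The part of the fibre over \<open>x\<close> on which \<open>D\<close> holds,
    read as a subset of \<open>B\<close>.\<close>
  define S where "S = {b \<in> elts E B. opair E x b \<in> elts E A \<and> D (opair E x b)}"
  have "\<exists>B'. elts E B' = S"
    unfolding S_def
    by (intro separation def_intros definable_subst[where Q = "\<lambda>a v. D a", OF _ D])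
  then obtain B' where B': "elts E B' = S" by blast
  have S_iff: "b \<in> S \<longleftrightarrow> opair E x b \<in> elts E A \<and> D (opair E x b)" for b
    using A unfolding S_def by auto
  have "definable E (\<lambda>v. related E R\<^sub>1 (v 0) (v (Suc 0)))"
    by (intro def_intros)
  from relation_comprehension[OF this, of B' B'] obtain r' where r': "elts E r' \<subseteq> cross E B' B'"
    "\<forall>b c. related E r' b c = (b \<in> elts E B' \<and> c \<in> elts E B' \<and> related E R\<^sub>1 b c)"
    by (elim exE conjE)
  have elts_r': "elts E r' = elts E R\<^sub>1 \<inter> cross E B' B'"
  proof (intro Set.set_eqI)
    fix p show "p \<in> elts E r' \<longleftrightarrow> p \<in> elts E R\<^sub>1 \<inter> cross E B' B'"
      using r' unfolding related_def cross_def by blast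
  qed
  have func: "is_function E \<pi> A A" and bij: "bij_betw (app E \<pi>) (elts E A) (elts E A)"
    using \<pi> unfolding bijection_def by auto
  \<comment> \<open>The map induced by \<open>\<pi>\<close> on second coordinates.\<close>
  define g where "g b = (THE c. app E \<pi> (opair E x b) = opair E x c)" for b
  have g: "app E \<pi> (opair E x b) = opair E x (g b)" if "b \<in> S" for b
    using first[of x b] that unfolding S_iff g_def by auto
  have g_in: "g b \<in> S" if "b \<in> S" for b
    using D_iff[of "opair E x b"] app_in[OF func, of "opair E x b"] that g[OF that]
    unfolding S_iff by auto
  have bij_g: "bij_betw g S S"
  proof (rule bij_betw_imageI)
    show "inj_on g S"
    proof (rule inj_onI)
      fix b c assume "b \<in> S" "c \<in> S" "g b = g c"
      then have "app E \<pi> (opair E x b) = app E \<pi> (opair E x c)" by (simp add: g)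
      with \<open>b \<in> S\<close> \<open>c \<in> S\<close> have "opair E x b = opair E x c"
        using bij unfolding S_iff by (auto simp: bij_betw_def dest: inj_onD)
      then show "b = c" by simp
    qed
    have "c \<in> g ` S" if "c \<in> S" for c
    proof -
      have "opair E x c \<in> app E \<pi> ` elts E A"
        using bij that unfolding S_iff bij_betw_def by simp
      then obtain a where a: "a \<in> elts E A" "app E \<pi> a = opair E x c" by auto
      then obtain y b where yb: "a = opair E y b" using A unfolding cross_def by blast
      \<comment> \<open>A preimage of a point of the fibre lies in the same fibre, because
        \<open>\<pi>\<close> preserves first coordinates.\<close>
      have "y = x" using first[of y b] a unfolding yb by auto
      moreover from this have "b \<in> S"
        using D_iff[OF a(1)] that a unfolding yb S_iff by simp
      moreover from this have "g b = c" using g a(2) yb \<open>y = x\<close> by simp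
      ultimately show ?thesis by blast
    qed
    then show "g ` S = S" using g_in by blast
  qed
  \<comment> \<open>With \<open>\<pi>\<close> and \<open>x\<close> as parameters the graph of
    \<open>g\<close> on \<open>S\<close> is definable, so \<open>g\<close> becomes a function
    \<open>f\<close> of the universe.\<close>
  have "definable E (\<lambda>v. related E \<pi> (opair E x (v 0)) (opair E x (v (Suc 0))))"
    by (intro def_intros)
  moreover have "related E \<pi> (opair E x b) (opair E x c) \<longleftrightarrow> c = g b" if "b \<in> S" for b c
    using related_iff_app[OF func, of "opair E x b"] g[OF that] that unfolding S_iff by auto
  ultimately have "\<exists>f. bijection E f B' B' \<and> (\<forall>x \<in> elts E B'. app E f x = g x)"
    using bij_g unfolding B'[symmetric]
    by (intro ex_bijection[where W = "\<lambda>b c. related E \<pi> (opair E x b) (opair E x c)"])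
  then obtain f where f: "bijection E f B' B'" "\<And>b. b \<in> S \<Longrightarrow> app E f b = g b"
    unfolding B' by blast
  have "related E r' b c \<longleftrightarrow> related E r' (app E f b) (app E f c)" if "b \<in> S" "c \<in> S" for b c
    using pres[of x b c "g b" "g c"] that g g_in
    unfolding r'(2)[rule_format] B' S_iff[symmetric] by (simp add: f(2) S_iff)
  then have "automorphism E f B' r'"
    using f(1) unfolding automorphism_def B' by blast
  moreover have "rigid E B' r'"
    using hered elts_r' B' unfolding hereditarily_rigid_def S_def by blast
  ultimately have "g b = b" if "b \<in> S" for b
    using f(2) that unfolding rigid_def B' by metis
  then show ?thesis using g[of b] a unfolding xb S_iff by simp
qed

subsection \<open>Copies of the natural numbers\<close>

text \<open>The Peano axioms with zero \<open>a\<close> and successor \<open>f\<close>, where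
  induction ranges over the sets of the universe. The successor is a HOL function with a definable
  graph, defined beyond \<open>Z\<close> too.\<close>

definition progression :: "'a \<Rightarrow> ('a \<Rightarrow> 'a) \<Rightarrow> 'a \<Rightarrow> bool" where
  "progression Z f a \<longleftrightarrow> definable_fun E (\<lambda>v. f (v 0)) \<and> a \<in> elts E Z \<and>
     f ` elts E Z \<subseteq> elts E Z \<and> inj_on f (elts E Z) \<and> a \<notin> f ` elts E Z \<and>
     (\<forall>S. a \<in> elts E S \<and> (\<forall>n \<in> elts E Z. n \<in> elts E S \<longrightarrow> f n \<in> elts E S) \<longrightarrow>
        elts E Z \<subseteq> elts E S)"

lemma progression_induct:
  assumes prog: "progression Z f a" and n: "n \<in> elts E Z"
    and def: "definable E (\<lambda>v. P (v 0))"
    and base: "P a" and step: "\<And>n. n \<in> elts E Z \<Longrightarrow> P n \<Longrightarrow> P (f n)"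
  shows "P n"
proof -
  obtain S where S: "elts E S = {n \<in> elts E Z. P n}" using separation[OF def] by blast
  have "a \<in> elts E S \<and> (\<forall>n \<in> elts E Z. n \<in> elts E S \<longrightarrow> f n \<in> elts E S)"
    using prog base step unfolding S progression_def by auto
  then have "elts E Z \<subseteq> elts E S" using prog unfolding progression_def by blast
  then show ?thesis using n unfolding S by auto
qed

lemma definable_fun_progression:
  "progression Z f a \<Longrightarrow> definable_fun E t \<Longrightarrow> definable_fun E (\<lambda>v. f (t v))"
  using definable_fun_comp unfolding progression_def by blast

text \<open>A fixed point at \<open>f n\<close> would by injectivity give one at \<open>n\<close>.
  This keeps the successor relation free of loops.\<close>

lemma progression_neq:
  assumes "progression Z f a" "n \<in> elts E Z"
  shows "f n \<noteq> n"
proof (rule progression_induct[OF assms, where P = "\<lambda>n. f n \<noteq> n"])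
  show "definable E (\<lambda>v. f (v 0) \<noteq> v 0)"
    by (intro def_intros definable_fun_progression[OF assms(1)])
  show "f a \<noteq> a" using assms(1) unfolding progression_def by force
  show "f (f n) \<noteq> f n" if "n \<in> elts E Z" "f n \<noteq> n" for n
    using assms(1) that unfolding progression_def by (metis image_subset_iff inj_onD)
qed

text \<open>The forward orbit of \<open>a\<close> satisfies induction by minimality. The invariant
  \<open>P\<close> fails at \<open>a\<close> but holds from \<open>f a\<close> onwards, so the orbit
  never returns to its start.\<close>

lemma orbit_progression:
  assumes f: "definable_fun E (\<lambda>v. f (v 0))" "f ` elts E A \<subseteq> elts E A" "inj_on f (elts E A)"
    and a: "a \<in> elts E A"
    and def: "definable E (\<lambda>v. P (v 0))"
    and P: "P (f a)" "\<not> P a" "\<And>n. n \<in> elts E A \<Longrightarrow> P n \<Longrightarrow> P (f n)"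
  shows "\<exists>Z. elts E Z \<subseteq> elts E A \<and> progression Z f a"
proof -
  \<comment> \<open>The orbit is the intersection of all sets that contain \<open>a\<close> and are
    closed under \<open>f\<close>, a first-order condition since \<open>S\<close> ranges over the
    universe.\<close>
  define Q where "Q b \<longleftrightarrow> (\<forall>S. a \<in> elts E S \<and>
    (\<forall>n \<in> elts E A. n \<in> elts E S \<longrightarrow> f n \<in> elts E S) \<longrightarrow> b \<in> elts E S)" for b
  have "\<exists>Z. elts E Z = {b \<in> elts E A. Q b}"
    unfolding Q_def by (intro separation def_intros definable_fun_comp[OF f(1)])
  then obtain Z where Z: "elts E Z = {b \<in> elts E A. Q b}" by blast
  have closed: "f n \<in> elts E Z" if "n \<in> elts E Z" for n
    using that f(2) unfolding Z Q_def by blast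
  have least: "elts E Z \<subseteq> elts E S"
    if S: "a \<in> elts E S" "\<forall>n \<in> elts E Z. n \<in> elts E S \<longrightarrow> f n \<in> elts E S" for S
  proof
    fix b assume b: "b \<in> elts E Z"
    \<comment> \<open>\<open>S\<close> is closed under \<open>f\<close> only at points of
      \<open>Z\<close>; its intersection with \<open>Z\<close> is closed at all points of
      \<open>A\<close>, as \<open>Q\<close> demands.\<close>
    have "\<exists>S'. elts E S' = {n \<in> elts E Z. n \<in> elts E S}"
      by (intro separation def_intros)
    then obtain S' where S': "elts E S' = {n \<in> elts E Z. n \<in> elts E S}"
      by blast
    have "a \<in> elts E Z" using a unfolding Z Q_def by blast
    then have "a \<in> elts E S' \<and> (\<forall>n \<in> elts E A. n \<in> elts E S' \<longrightarrow> f n \<in> elts E S')"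
      using S closed unfolding S' by blast
    then have "b \<in> elts E S'" using b unfolding Z Q_def by blast
    then show "b \<in> elts E S" unfolding S' by blast
  qed
  \<comment> \<open>Every orbit point is \<open>a\<close> or satisfies \<open>P\<close>, hence every
    value of \<open>f\<close> on the orbit satisfies \<open>P\<close> and differs from
    \<open>a\<close>.\<close>
  have "\<exists>S. elts E S = {n \<in> elts E A. n = a \<or> P n}"
    by (intro separation def_intros def)
  then obtain S where S: "elts E S = {n \<in> elts E A. n = a \<or> P n}" by blast
  have "elts E Z \<subseteq> elts E S"
    using a f(2) P(1,3) by (intro least) (auto simp: S Z)
  then have "a \<notin> f ` elts E Z"
    using P unfolding S by auto
  moreover have "a \<in> elts E Z" using a unfolding Z Q_def by blast
  moreover have "inj_on f (elts E Z)" using f(3) unfolding Z by (auto simp: inj_on_def)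
  ultimately have "progression Z f a"
    using f(1) closed least unfolding progression_def by blast
  then show ?thesis using Z by blast
qed

end

section \<open>The real line\<close>

locale real_line = zf +
  fixes R pl tm z e lt :: 'a
  assumes real_field: "real_field E R pl tm z e lt"
begin

abbreviation K :: "'a ring" where "K \<equiv> ring_of E R pl tm z e"

sublocale K: field K
  using real_field unfolding real_field_def by blast

abbreviation less :: "'a \<Rightarrow> 'a \<Rightarrow> bool" (infix "\<prec>" 50) where "x \<prec> y \<equiv> related E lt x y"

text \<open>The negated form matches the upper bounds in the completeness axiom literally; by
  linearity it is the usual weak order on the field.\<close>

abbreviation le :: "'a \<Rightarrow> 'a \<Rightarrow> bool" (infix "\<preceq>" 50) where "x \<preceq> y \<equiv> \<not> y \<prec> x"

lemma ring_of_simps [simp]: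
  "carrier K = elts E R" "\<zero>\<^bsub>K\<^esub> = z" "\<one>\<^bsub>K\<^esub> = e"
  by (simp_all add: ring_of_def)

lemmas K_closed [simp, intro] =
  K.add.m_closed[unfolded ring_of_simps] K.m_closed[unfolded ring_of_simps]
  K.zero_closed[unfolded ring_of_simps] K.one_closed[unfolded ring_of_simps]
  K.a_inv_closed[unfolded ring_of_simps]

lemmas K_simps [simp] =
  K.l_zero[unfolded ring_of_simps] K.r_zero[unfolded ring_of_simps]
  K.l_neg[unfolded ring_of_simps] K.r_neg[unfolded ring_of_simps]
  K.minus_minus[unfolded ring_of_simps]
  K.l_one[unfolded ring_of_simps] K.r_one[unfolded ring_of_simps]
  K.l_minus[unfolded ring_of_simps] K.r_minus[unfolded ring_of_simps]

lemmas order_axioms = real_field[unfolded real_field_def, THEN conjunct2, THEN conjunct2,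
    THEN conjunct2, THEN conjunct2]

section \<open>Order and arithmetic of the field\<close>

lemma less_irrefl: "x \<in> elts E R \<Longrightarrow> \<not> x \<prec> x"
  using order_axioms[THEN conjunct1] by (rule bspec)

lemma less_trans:
  assumes "x \<in> elts E R" "y \<in> elts E R" "w \<in> elts E R" "x \<prec> y" "y \<prec> w"
  shows "x \<prec> w"
  using order_axioms[THEN conjunct2, THEN conjunct1] assms by blast

lemma less_linear: "x \<in> elts E R \<Longrightarrow> y \<in> elts E R \<Longrightarrow> x \<prec> y \<or> x = y \<or> y \<prec> x"
  using order_axioms[THEN conjunct2, THEN conjunct2, THEN conjunct1] by blast

lemma add_less:
  assumes "x \<in> elts E R" "y \<in> elts E R" "w \<in> elts E R" "x \<prec> y"
  shows "x \<oplus>\<^bsub>K\<^esub> w \<prec> y \<oplus>\<^bsub>K\<^esub> w"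
  using order_axioms[THEN conjunct2, THEN conjunct2, THEN conjunct2, THEN conjunct1] assms
  by (simp add: ring_of_def)

lemma mult_pos:
  assumes "x \<in> elts E R" "y \<in> elts E R" "z \<prec> x" "z \<prec> y"
  shows "z \<prec> x \<otimes>\<^bsub>K\<^esub> y"
  using order_axioms[THEN conjunct2, THEN conjunct2, THEN conjunct2, THEN conjunct2, THEN conjunct1]
    assms
  by (simp add: ring_of_def)

lemma complete:
  assumes "elts E S \<subseteq> elts E R" "elts E S \<noteq> {}" "u \<in> elts E R" "\<forall>x \<in> elts E S. x \<preceq> u"
  shows "\<exists>s \<in> elts E R. (\<forall>x \<in> elts E S. x \<preceq> s) \<and>
    (\<forall>u \<in> elts E R. (\<forall>x \<in> elts E S. x \<preceq> u) \<longrightarrow> s \<preceq> u)"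
  using order_axioms[THEN conjunct2, THEN conjunct2, THEN conjunct2, THEN conjunct2, THEN conjunct2,
      rule_format, of S] assms
  by blast

lemma le_trans:
  assumes "x \<in> elts E R" "y \<in> elts E R" "w \<in> elts E R" "x \<preceq> y" "y \<preceq> w"
  shows "x \<preceq> w"
  using assms less_trans[of x y w] less_trans[of w x y] less_trans[of y w x] less_linear[of x y]
    less_linear[of y w] less_linear[of x w] less_irrefl by blast

lemma le_less_trans:
  assumes "x \<in> elts E R" "y \<in> elts E R" "w \<in> elts E R" "x \<preceq> y" "y \<prec> w"
  shows "x \<prec> w"
  using assms less_trans[of x y w] less_trans[of w x y] less_trans[of y w x] less_linear[of x y]
    less_linear[of y w] less_linear[of x w] less_irrefl by blast

lemma less_le_trans:
  assumes "x \<in> elts E R" "y \<in> elts E R" "w \<in> elts E R" "x \<prec> y" "y \<preceq> w"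
  shows "x \<prec> w"
  using assms less_trans[of x y w] less_trans[of w x y] less_trans[of y w x] less_linear[of x y]
    less_linear[of y w] less_linear[of x w] less_irrefl by blast

lemma less_imp_le: "x \<in> elts E R \<Longrightarrow> y \<in> elts E R \<Longrightarrow> x \<prec> y \<Longrightarrow> x \<preceq> y"
  using less_trans less_irrefl by blast

lemma add_less_cancel:
  assumes "x \<in> elts E R" "y \<in> elts E R" "w \<in> elts E R"
  shows "x \<oplus>\<^bsub>K\<^esub> w \<prec> y \<oplus>\<^bsub>K\<^esub> w \<longleftrightarrow> x \<prec> y"
proof
  assume "x \<oplus>\<^bsub>K\<^esub> w \<prec> y \<oplus>\<^bsub>K\<^esub> w"
  then have "\<not> y \<prec> x" "y \<noteq> x"
    using assms less_imp_le[OF _ _ add_less[of y x w]] less_irrefl by auto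
  then show "x \<prec> y" using less_linear assms by blast
qed (use assms add_less in blast)

lemma add_le_mono:
  assumes "x \<in> elts E R" "y \<in> elts E R" "u \<in> elts E R" "w \<in> elts E R" "x \<preceq> y" "u \<preceq> w"
  shows "x \<oplus>\<^bsub>K\<^esub> u \<preceq> y \<oplus>\<^bsub>K\<^esub> w"
proof (rule le_trans)
  show "x \<oplus>\<^bsub>K\<^esub> u \<preceq> y \<oplus>\<^bsub>K\<^esub> u" using assms by (simp add: add_less_cancel)
  have "u \<oplus>\<^bsub>K\<^esub> y \<preceq> w \<oplus>\<^bsub>K\<^esub> y" using assms by (simp add: add_less_cancel)
  then show "y \<oplus>\<^bsub>K\<^esub> u \<preceq> y \<oplus>\<^bsub>K\<^esub> w" using assms by (simp add: K.a_comm)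
qed (simp_all add: assms)

lemma less_iff_diff:
  assumes "x \<in> elts E R" "y \<in> elts E R"
  shows "x \<prec> y \<longleftrightarrow> z \<prec> y \<oplus>\<^bsub>K\<^esub> \<ominus>\<^bsub>K\<^esub> x"
  using add_less_cancel[of x y "\<ominus>\<^bsub>K\<^esub> x"] assms by simp

text \<open>If one were negative, its negative would be positive, and so would the square of that,
  which is one.\<close>

lemma one_pos: "z \<prec> e"
proof (rule ccontr)
  assume "\<not> z \<prec> e"
  then have "e \<prec> z" using less_linear[of z e] K.one_not_zero by auto
  then have "z \<prec> \<ominus>\<^bsub>K\<^esub> e" using less_iff_diff[of e z] by simp
  then have "z \<prec> \<ominus>\<^bsub>K\<^esub> e \<otimes>\<^bsub>K\<^esub> \<ominus>\<^bsub>K\<^esub> e" by (intro mult_pos) auto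
  also have "\<ominus>\<^bsub>K\<^esub> e \<otimes>\<^bsub>K\<^esub> \<ominus>\<^bsub>K\<^esub> e = e"
    by simp
  finally show False using \<open>\<not> z \<prec> e\<close> by simp
qed

lemma neg_less_zero_iff: "x \<in> elts E R \<Longrightarrow> \<ominus>\<^bsub>K\<^esub> x \<prec> z \<longleftrightarrow> z \<prec> x"
  using add_less_cancel[of "\<ominus>\<^bsub>K\<^esub> x" z x] by simp

text \<open>An Archimedean property. For \<open>d\<close> in \<open>S\<close>, the sum of
  \<open>d\<close> and \<open>c\<close> is at most twice the larger of them, which lies in
  \<open>S\<close>. So the supremum minus \<open>c\<close> is already an upper bound.\<close>

lemma no_bounded_doubling:
  assumes S: "elts E S \<subseteq> elts E R" "\<And>d. d \<in> elts E S \<Longrightarrow> d \<oplus>\<^bsub>K\<^esub> d \<in> elts E S"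
    and u: "u \<in> elts E R" "\<forall>d \<in> elts E S. d \<preceq> u"
    and c: "c \<in> elts E S" "z \<prec> c"
  shows False
proof -
  have "elts E S \<noteq> {}" using c(1) by auto
  from complete[OF S(1) this u] obtain s where s: "s \<in> elts E R" "\<forall>d \<in> elts E S. d \<preceq> s"
    "\<forall>u \<in> elts E R. (\<forall>d \<in> elts E S. d \<preceq> u) \<longrightarrow> s \<preceq> u"
    by (elim bexE conjE)
  have cR: "c \<in> elts E R" using c S by blast
  define t where "t = s \<oplus>\<^bsub>K\<^esub> \<ominus>\<^bsub>K\<^esub> c"
  have tR: "t \<in> elts E R" using s(1) cR unfolding t_def by simp
  have t: "t \<oplus>\<^bsub>K\<^esub> c = s"
    unfolding t_def using s(1) cR by (simp add: K.a_assoc)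
  have "d \<preceq> t" if d: "d \<in> elts E S" for d
  proof -
    have dR: "d \<in> elts E R" using d S by blast
    have "d \<oplus>\<^bsub>K\<^esub> c \<preceq> s"
    proof (cases "c \<preceq> d")
      case True
      then have "d \<oplus>\<^bsub>K\<^esub> c \<preceq> d \<oplus>\<^bsub>K\<^esub> d"
        using dR cR less_irrefl by (intro add_le_mono) auto
      then show ?thesis
        using le_trans[of "d \<oplus>\<^bsub>K\<^esub> c" "d \<oplus>\<^bsub>K\<^esub> d" s] s S(2)[OF d] dR cR by auto
    next
      case False
      then have "d \<oplus>\<^bsub>K\<^esub> c \<preceq> c \<oplus>\<^bsub>K\<^esub> c"
        using dR cR less_irrefl less_imp_le by (intro add_le_mono) auto
      then show ?thesis
        using le_trans[of "d \<oplus>\<^bsub>K\<^esub> c" "c \<oplus>\<^bsub>K\<^esub> c" s] s S(2)[OF c(1)] dR cR by auto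
    qed
    then show ?thesis using add_less_cancel[OF tR dR cR] t by simp
  qed
  then have "s \<preceq> t" using s(3) tR by blast
  moreover have "t \<prec> s"
    using add_less_cancel[of z c t] tR cR c(2) t by (simp add: K.a_comm)
  ultimately show False by blast
qed

subsection \<open>Coding reals by subsets of a progression\<close>

text \<open>Going through \<open>fapp\<close> keeps the operation definable on the whole universe,
  while the ring operation takes unspecified values outside \<open>R\<close>.\<close>

definition plus :: "'a \<Rightarrow> 'a \<Rightarrow> 'a" where "plus x y = fapp pl (opair E x y)"

definition times :: "'a \<Rightarrow> 'a \<Rightarrow> 'a" where "times x y = fapp tm (opair E x y)"

lemma definable_fun_plus:
  "definable_fun E s \<Longrightarrow> definable_fun E t \<Longrightarrow> definable_fun E (\<lambda>v. plus (s v) (t v))"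
  unfolding plus_def by (intro definable_fun_fapp def_intros)

lemma definable_fun_times:
  "definable_fun E s \<Longrightarrow> definable_fun E t \<Longrightarrow> definable_fun E (\<lambda>v. times (s v) (t v))"
  unfolding times_def by (intro definable_fun_fapp def_intros)

lemma fapp_binary_operation:
  assumes "binary_operation E f R" "x \<in> elts E R" "y \<in> elts E R"
  shows "fapp f (opair E x y) = app2 E f x y"
proof -
  obtain D where "elts E D = cross E R R" "is_function E f D R"
    using assms(1) unfolding binary_operation_def by blast
  then show ?thesis using fapp_eq_app[of f D R "opair E x y"] assms unfolding app2_def by simp
qed

lemma plus_eq [simp]: "x \<in> elts E R \<Longrightarrow> y \<in> elts E R \<Longrightarrow> plus x y = x \<oplus>\<^bsub>K\<^esub> y"
  using fapp_binary_operation[OF real_field[unfolded real_field_def, THEN conjunct1]]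
  by (simp add: plus_def ring_of_def)

lemma times_eq [simp]: "x \<in> elts E R \<Longrightarrow> y \<in> elts E R \<Longrightarrow> times x y = x \<otimes>\<^bsub>K\<^esub> y"
  using fapp_binary_operation[OF real_field[unfolded real_field_def, THEN conjunct2, THEN conjunct1]]
  by (simp add: times_def ring_of_def)

text \<open>The binary doubling map moved to \<open>[-1, 1]\<close>: two branches of slope two, and
  the sign of the point, zero counting as positive, is the current digit.\<close>

definition dbl :: "'a \<Rightarrow> 'a" where
  "dbl x = (if x \<prec> z then plus (plus x x) e else plus (plus x x) (\<ominus>\<^bsub>K\<^esub> e))"

definition interval :: "'a set" where
  "interval = {x \<in> elts E R. \<ominus>\<^bsub>K\<^esub> e \<preceq> x \<and> x \<preceq> e}"

lemma definable_fun_dbl: "definable_fun E t \<Longrightarrow> definable_fun E (\<lambda>v. dbl (t v))"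
  unfolding dbl_def by (intro def_intros definable_fun_plus)

lemma dbl_closed [simp]: "x \<in> elts E R \<Longrightarrow> dbl x \<in> elts E R"
  unfolding dbl_def by simp

lemma dbl_interval:
  assumes "x \<in> interval"
  shows "dbl x \<in> interval"
proof -
  have x: "x \<in> elts E R" "\<ominus>\<^bsub>K\<^esub> e \<preceq> x" "x \<preceq> e" using assms unfolding interval_def by auto
  have refl: "w \<preceq> w" if "w \<in> elts E R" for w using less_irrefl that by blast
  have e: "\<ominus>\<^bsub>K\<^esub> e \<oplus>\<^bsub>K\<^esub> \<ominus>\<^bsub>K\<^esub> e \<oplus>\<^bsub>K\<^esub> e = \<ominus>\<^bsub>K\<^esub> e" "e \<oplus>\<^bsub>K\<^esub> e \<oplus>\<^bsub>K\<^esub> \<ominus>\<^bsub>K\<^esub> e = e"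
    by (simp_all add: K.a_assoc)
  show ?thesis
  proof (cases "x \<prec> z")
    case True
    then have "x \<preceq> z" using less_imp_le x by blast
    then have "x \<oplus>\<^bsub>K\<^esub> x \<oplus>\<^bsub>K\<^esub> e \<preceq> z \<oplus>\<^bsub>K\<^esub> z \<oplus>\<^bsub>K\<^esub> e"
      using x refl by (intro add_le_mono) auto
    moreover have "\<ominus>\<^bsub>K\<^esub> e \<oplus>\<^bsub>K\<^esub> \<ominus>\<^bsub>K\<^esub> e \<oplus>\<^bsub>K\<^esub> e \<preceq> x \<oplus>\<^bsub>K\<^esub> x \<oplus>\<^bsub>K\<^esub> e"
      using x refl by (intro add_le_mono) auto
    ultimately show ?thesis using True x unfolding interval_def dbl_def by (simp add: e)
  next
    case False
    have "z \<oplus>\<^bsub>K\<^esub> z \<oplus>\<^bsub>K\<^esub> \<ominus>\<^bsub>K\<^esub> e \<preceq> x \<oplus>\<^bsub>K\<^esub> x \<oplus>\<^bsub>K\<^esub> \<ominus>\<^bsub>K\<^esub> e"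
      using False x refl by (intro add_le_mono) auto
    moreover have "x \<oplus>\<^bsub>K\<^esub> x \<oplus>\<^bsub>K\<^esub> \<ominus>\<^bsub>K\<^esub> e \<preceq> e \<oplus>\<^bsub>K\<^esub> e \<oplus>\<^bsub>K\<^esub> \<ominus>\<^bsub>K\<^esub> e"
      using x refl by (intro add_le_mono) auto
    ultimately show ?thesis using False x unfolding interval_def dbl_def by (simp add: e)
  qed
qed

text \<open>On a common branch the constant terms agree, so the distance doubles.\<close>

lemma dbl_add:
  assumes "x \<in> elts E R" "d \<in> elts E R" "x \<prec> z \<longleftrightarrow> x \<oplus>\<^bsub>K\<^esub> d \<prec> z"
  shows "dbl (x \<oplus>\<^bsub>K\<^esub> d) = dbl x \<oplus>\<^bsub>K\<^esub> (d \<oplus>\<^bsub>K\<^esub> d)"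
  using assms unfolding dbl_def by (simp add: K.a_ac)

text \<open>Multiply by the positive \<open>w\<close>: a negative \<open>y\<close> would make minus
  one positive, and \<open>y\<close> above one would put \<open>w\<close> below one.\<close>

lemma inverse_bounds:
  assumes "w \<in> elts E R" "e \<preceq> w" "y \<in> elts E R" "y \<otimes>\<^bsub>K\<^esub> w = e"
  shows "z \<prec> y" "y \<preceq> e"
proof -
  have w: "z \<prec> w" using less_le_trans[of z e w] one_pos assms by simp
  show "z \<prec> y"
  proof (rule ccontr)
    assume "\<not> z \<prec> y"
    moreover have "y \<noteq> z"
      using assms K.l_null[of w] K.one_not_zero by auto
    ultimately have "y \<prec> z" using less_linear[of y z] assms by simp
    then have "z \<prec> \<ominus>\<^bsub>K\<^esub> y" using less_iff_diff[of y z] assms by simp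
    then have "z \<prec> \<ominus>\<^bsub>K\<^esub> y \<otimes>\<^bsub>K\<^esub> w" using w assms by (intro mult_pos) auto
    also have "\<ominus>\<^bsub>K\<^esub> y \<otimes>\<^bsub>K\<^esub> w = \<ominus>\<^bsub>K\<^esub> e" using assms by simp
    finally have "\<not> \<ominus>\<^bsub>K\<^esub> e \<prec> z" by (intro less_imp_le) auto
    then show False using neg_less_zero_iff[of e] one_pos by simp
  qed
  show "y \<preceq> e"
  proof
    assume "e \<prec> y"
    then have "z \<prec> y \<oplus>\<^bsub>K\<^esub> \<ominus>\<^bsub>K\<^esub> e" using less_iff_diff[of e y] assms by simp
    then have "z \<prec> (y \<oplus>\<^bsub>K\<^esub> \<ominus>\<^bsub>K\<^esub> e) \<otimes>\<^bsub>K\<^esub> w" using w assms by (intro mult_pos) auto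
    also have "(y \<oplus>\<^bsub>K\<^esub> \<ominus>\<^bsub>K\<^esub> e) \<otimes>\<^bsub>K\<^esub> w = e \<oplus>\<^bsub>K\<^esub> \<ominus>\<^bsub>K\<^esub> w"
      using assms K.l_distr[of y "\<ominus>\<^bsub>K\<^esub> e" w] by simp
    finally show False using less_iff_diff[of w e] assms by simp
  qed
qed

text \<open>The graph of an injection of the real line into the interval: 1/(x + 1) for positive x and
  1/(x - 1) otherwise.\<close>

definition squash :: "'a \<Rightarrow> 'a \<Rightarrow> bool" where
  "squash x y \<longleftrightarrow> (if z \<prec> x then times y (plus x e) = e else times y (plus x (\<ominus>\<^bsub>K\<^esub> e)) = e)"

lemma definable_squash:
  "definable_fun E s \<Longrightarrow> definable_fun E t \<Longrightarrow> definable E (\<lambda>v. squash (s v) (t v))"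
  unfolding squash_def if_bool_eq_conj
  by (intro def_intros definable_fun_plus definable_fun_times)

text \<open>The sign survives, so a value of \<open>squash\<close> reveals which branch produced
  it.\<close>

lemma squash_range:
  assumes "x \<in> elts E R" "y \<in> elts E R" "squash x y"
  shows "y \<in> interval" "z \<prec> y \<longleftrightarrow> z \<prec> x"
proof -
  have neg: "\<ominus>\<^bsub>K\<^esub> e \<prec> z" using neg_less_zero_iff[of e] one_pos by simp
  have "y \<in> interval \<and> (z \<prec> y \<longleftrightarrow> z \<prec> x)"
  proof (cases "z \<prec> x")
    case True
    have "z \<oplus>\<^bsub>K\<^esub> e \<prec> x \<oplus>\<^bsub>K\<^esub> e" using True assms by (intro add_less) auto
    then have "e \<preceq> x \<oplus>\<^bsub>K\<^esub> e" using assms by (intro less_imp_le) auto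
    moreover have "y \<otimes>\<^bsub>K\<^esub> (x \<oplus>\<^bsub>K\<^esub> e) = e" using assms True unfolding squash_def by simp
    ultimately have "z \<prec> y" "y \<preceq> e" using inverse_bounds[of "x \<oplus>\<^bsub>K\<^esub> e" y] assms by auto
    moreover have "\<ominus>\<^bsub>K\<^esub> e \<preceq> y"
      using neg \<open>z \<prec> y\<close> assms less_trans[of "\<ominus>\<^bsub>K\<^esub> e" z y] by (intro less_imp_le) auto
    ultimately show ?thesis using True assms unfolding interval_def by simp
  next
    case False
    \<comment> \<open>Here \<open>w\<close> is at most minus one, so the bounds on inverses are
      applied to the negatives of \<open>w\<close> and \<open>y\<close>.\<close>
    define w where "w = x \<oplus>\<^bsub>K\<^esub> \<ominus>\<^bsub>K\<^esub> e"
    have w: "w \<in> elts E R" using assms unfolding w_def by simp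
    have yw: "y \<otimes>\<^bsub>K\<^esub> w = e" using assms False unfolding squash_def w_def by simp
    have "e \<preceq> \<ominus>\<^bsub>K\<^esub> w"
    proof
      assume "\<ominus>\<^bsub>K\<^esub> w \<prec> e"
      then have "\<ominus>\<^bsub>K\<^esub> w \<oplus>\<^bsub>K\<^esub> w \<prec> e \<oplus>\<^bsub>K\<^esub> w" using w by (intro add_less) auto
      also have "e \<oplus>\<^bsub>K\<^esub> w = x"
        unfolding w_def using assms K.r_neg2[of e x] K.a_comm[of x "\<ominus>\<^bsub>K\<^esub> e"] by simp
      finally show False using False w by simp
    qed
    moreover have "\<ominus>\<^bsub>K\<^esub> y \<otimes>\<^bsub>K\<^esub> \<ominus>\<^bsub>K\<^esub> w = e" using w assms yw by simp
    ultimately have y: "z \<prec> \<ominus>\<^bsub>K\<^esub> y" "\<ominus>\<^bsub>K\<^esub> y \<preceq> e"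
      using inverse_bounds[of "\<ominus>\<^bsub>K\<^esub> w" "\<ominus>\<^bsub>K\<^esub> y"] assms w by auto
    then have "y \<prec> z" using neg_less_zero_iff[of "\<ominus>\<^bsub>K\<^esub> y"] assms by simp
    moreover from this have "y \<preceq> e"
      using one_pos assms less_trans[of y z e] by (intro less_imp_le) auto
    moreover have "\<ominus>\<^bsub>K\<^esub> e \<preceq> y"
      using y(2) less_iff_diff[of y "\<ominus>\<^bsub>K\<^esub> e"] less_iff_diff[of e "\<ominus>\<^bsub>K\<^esub> y"] assms
      by (simp add: K.a_comm)
    moreover have "\<not> z \<prec> y" using \<open>y \<prec> z\<close> assms by (intro less_imp_le) auto
    ultimately show ?thesis using False assms unfolding interval_def by simp
  qed
  then show "y \<in> interval" "z \<prec> y \<longleftrightarrow> z \<prec> x" by auto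
qed

lemma squash_total:
  assumes "x \<in> elts E R"
  shows "\<exists>y \<in> elts E R. squash x y"
proof -
  have inv: "\<exists>y \<in> elts E R. y \<otimes>\<^bsub>K\<^esub> w = e" if "w \<in> elts E R" "w \<noteq> z" for w
    using that K.field_Units K.Units_l_inv_ex[of w] by auto
  show ?thesis
  proof (cases "z \<prec> x")
    case True
    have "z \<prec> x \<oplus>\<^bsub>K\<^esub> e"
      using add_less[of z x e] True assms one_pos less_trans[of z e "x \<oplus>\<^bsub>K\<^esub> e"] by simp
    then have "x \<oplus>\<^bsub>K\<^esub> e \<noteq> z" using less_irrefl[of z] by auto
    then show ?thesis using inv[of "x \<oplus>\<^bsub>K\<^esub> e"] True assms unfolding squash_def by auto
  next
    case False
    then have "e \<noteq> x" using one_pos by auto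
    then have "x \<oplus>\<^bsub>K\<^esub> \<ominus>\<^bsub>K\<^esub> e \<noteq> z"
      using K.a_assoc[of x "\<ominus>\<^bsub>K\<^esub> e" e] assms by auto
    then show ?thesis using inv[of "x \<oplus>\<^bsub>K\<^esub> \<ominus>\<^bsub>K\<^esub> e"] False assms unfolding squash_def by auto
  qed
qed

lemma squash_inject:
  assumes "x \<in> elts E R" "x' \<in> elts E R" "y \<in> elts E R" "squash x y" "squash x' y"
  shows "x = x'"
proof -
  \<comment> \<open>The shift in the denominator; it is common to \<open>x\<close> and
    \<open>x'\<close>, whose signs both agree with that of \<open>y\<close>.\<close>
  define c where "c = (if z \<prec> x then e else \<ominus>\<^bsub>K\<^esub> e)"
  have c: "c \<in> elts E R" unfolding c_def by simp
  have "z \<prec> x \<longleftrightarrow> z \<prec> x'" using squash_range(2) assms by blast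
  then have eq: "y \<otimes>\<^bsub>K\<^esub> (x \<oplus>\<^bsub>K\<^esub> c) = e" "y \<otimes>\<^bsub>K\<^esub> (x' \<oplus>\<^bsub>K\<^esub> c) = e"
    using assms unfolding squash_def c_def by (auto split: if_splits)
  have "y \<noteq> z"
    using eq(1) K.l_null[of "x \<oplus>\<^bsub>K\<^esub> c"] c assms K.one_not_zero by auto
  then have "x \<oplus>\<^bsub>K\<^esub> c = x' \<oplus>\<^bsub>K\<^esub> c"
    using eq K.m_lcancel[of y "x \<oplus>\<^bsub>K\<^esub> c" "x' \<oplus>\<^bsub>K\<^esub> c"] c assms by simp
  then show ?thesis using c assms K.add.right_cancel[of c x x'] by simp
qed

lemma squash_unique:
  assumes "x \<in> elts E R" "y \<in> elts E R" "y' \<in> elts E R" "squash x y" "squash x y'"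
  shows "y = y'"
proof -
  define w where "w = x \<oplus>\<^bsub>K\<^esub> (if z \<prec> x then e else \<ominus>\<^bsub>K\<^esub> e)"
  have w: "w \<in> elts E R" using assms unfolding w_def by simp
  have eq: "y \<otimes>\<^bsub>K\<^esub> w = e" "y' \<otimes>\<^bsub>K\<^esub> w = e"
    using assms unfolding squash_def w_def by (auto split: if_splits)
  have "w \<noteq> z"
    using eq(1) K.r_null[of y] assms K.one_not_zero by auto
  then show ?thesis
    using eq K.m_rcancel[of w y y'] w assms by simp
qed

text \<open>The itinerary of a point under the doubling map, where the stages of the orbit are counted by
  the progression \<open>a\<close>, \<open>f a\<close>, \<open>f (f a)\<close>, \<open>\<dots>\<close>: the pair \<open>(n, y)\<close> is reached from \<open>(a, x)\<close> by
  iterating \<open>(n, y) \<mapsto> (f n, dbl y)\<close>.\<close>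

definition reach :: "'a \<Rightarrow> ('a \<Rightarrow> 'a) \<Rightarrow> 'a \<Rightarrow> 'a \<Rightarrow> 'a \<Rightarrow> 'a \<Rightarrow> bool" where
  "reach Z f a x n y \<longleftrightarrow> (\<forall>S. related E S a x \<and>
     (\<forall>m \<in> elts E Z. \<forall>w \<in> elts E R. related E S m w \<longrightarrow> related E S (f m) (dbl w)) \<longrightarrow>
     related E S n y)"

definition itinerary :: "'a \<Rightarrow> ('a \<Rightarrow> 'a) \<Rightarrow> 'a \<Rightarrow> 'a \<Rightarrow> 'a \<Rightarrow> bool" where
  "itinerary Z f a x n \<longleftrightarrow> (\<exists>y \<in> elts E R. z \<preceq> y \<and> reach Z f a x n y)"

lemma definable_itinerary:
  assumes "progression Z f a" "definable_fun E s" "definable_fun E t"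
  shows "definable E (\<lambda>v. itinerary Z f a (s v) (t v))"
proof (rule definable_subst2[OF assms(2,3)])
  show "definable E (\<lambda>v. itinerary Z f a (v 0) (v (Suc 0)))"
    unfolding itinerary_def reach_def
    by (intro def_intros definable_fun_progression[OF assms(1)] definable_fun_dbl)
qed

lemma reach_start:
  assumes prog: "progression Z f a" and "x \<in> elts E R" "y \<in> elts E R"
  shows "reach Z f a x a y \<longleftrightarrow> y = x"
proof
  assume reach: "reach Z f a x a y"
  \<comment> \<open>The test relation holds all pairs except those with stage \<open>a\<close> and a
    point other than \<open>x\<close>. It is closed because \<open>a\<close> is no
    successor.\<close>
  have "definable E (\<lambda>v. v 0 = a \<longrightarrow> v (Suc 0) = x)" by (intro def_intros)
  from relation_comprehension[OF this, of Z R] obtain S where "elts E S \<subseteq> cross E Z R" and S_all: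
    "\<forall>m w. related E S m w = (m \<in> elts E Z \<and> w \<in> elts E R \<and> (m = a \<longrightarrow> w = x))"
    by (elim exE conjE)
  note S = S_all[rule_format]
  have "related E S a y"
    using reach[unfolded reach_def, rule_format, of S] prog assms
    unfolding S progression_def by auto
  then show "y = x" unfolding S by blast
qed (simp add: reach_def)

text \<open>Orbits of \<open>dbl x\<close> are orbits of \<open>x\<close> with the first point
  dropped; each direction transports a closed relation by one stage.\<close>

lemma reach_step:
  assumes prog: "progression Z f a" and "x \<in> elts E R" "y \<in> elts E R" "n \<in> elts E Z"
  shows "reach Z f a (dbl x) n y \<longleftrightarrow> reach Z f a x (f n) y"
proof
  have f: "f m \<in> elts E Z" "f m \<noteq> a" if "m \<in> elts E Z" for m
    using prog that unfolding progression_def by auto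
  have a: "a \<in> elts E Z" using prog unfolding progression_def by blast
  note def_f = definable_fun_progression[OF prog]
  {
    assume reach: "reach Z f a (dbl x) n y"
    show "reach Z f a x (f n) y"
      unfolding reach_def
    proof (intro allI impI, elim conjE)
      fix S
      assume start: "related E S a x" and closed: "\<forall>m \<in> elts E Z. \<forall>w \<in> elts E R.
        related E S m w \<longrightarrow> related E S (f m) (dbl w)"
      \<comment> \<open>\<open>T\<close> is \<open>S\<close> pulled back by one stage; it contains
        \<open>(a, dbl x)\<close> because \<open>S\<close> is closed and contains
        \<open>(a, x)\<close>.\<close>
      have "definable E (\<lambda>v. related E S (f (v 0)) (v (Suc 0)))" by (intro def_intros def_f)
      from relation_comprehension[OF this, of Z R] obtain T where "elts E T \<subseteq> cross E Z R" and T_all: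
        "\<forall>m w. related E T m w = (m \<in> elts E Z \<and> w \<in> elts E R \<and> related E S (f m) w)"
        by (elim exE conjE)
      note T = T_all[rule_format]
      have "related E T n y"
        using reach[unfolded reach_def, rule_format, of T] start closed a f assms
        unfolding T by auto
      then show "related E S (f n) y" unfolding T by blast
    qed
  next
    assume reach: "reach Z f a x (f n) y"
    show "reach Z f a (dbl x) n y"
      unfolding reach_def
    proof (intro allI impI, elim conjE)
      fix S
      assume start: "related E S a (dbl x)" and closed: "\<forall>m \<in> elts E Z. \<forall>w \<in> elts E R.
        related E S m w \<longrightarrow> related E S (f m) (dbl w)"
      \<comment> \<open>\<open>T\<close> is \<open>S\<close> pushed forward by one stage, with the
        new starting pair \<open>(a, x)\<close> added.\<close>
      have "definable E (\<lambda>v. v 0 = a \<and> v (Suc 0) = x \<or>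
          (\<exists>k \<in> elts E Z. v 0 = f k \<and> related E S k (v (Suc 0))))"
        by (intro def_intros def_f)
      from relation_comprehension[OF this, of Z R] obtain T where "elts E T \<subseteq> cross E Z R" and T_all:
        "\<forall>m w. related E T m w = (m \<in> elts E Z \<and> w \<in> elts E R \<and>
          (m = a \<and> w = x \<or> (\<exists>k \<in> elts E Z. m = f k \<and> related E S k w)))"
        by (elim exE conjE)
      note T = T_all[rule_format]
      have "related E T (f m) (dbl w)" if "m \<in> elts E Z" "w \<in> elts E R" "related E T m w" for m w
      proof -
        \<comment> \<open>The pair \<open>(m, w)\<close> is either the new start, whose image starts
          \<open>S\<close>, or comes from stage \<open>k\<close> of \<open>S\<close>, which is
          closed.\<close>
        have "related E S m (dbl w)"
          using that start closed unfolding T by auto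
        then show ?thesis using that f unfolding T by auto
      qed
      moreover have "related E T a x" using a assms unfolding T by simp
      ultimately have "related E T (f n) y"
        using reach[unfolded reach_def, rule_format, of T] by blast
      then obtain k where "k \<in> elts E Z" "f n = f k" "related E S k y"
        using f(2)[OF assms(4)] unfolding T by auto
      moreover have "n = k"
        using prog calculation assms unfolding progression_def by (auto dest: inj_onD)
      ultimately show "related E S n y" by simp
    qed
  }
qed

lemma itinerary_start:
  assumes "progression Z f a" "x \<in> elts E R"
  shows "itinerary Z f a x a \<longleftrightarrow> z \<preceq> x"
  unfolding itinerary_def using reach_start[OF assms] assms(2) by auto

lemma itinerary_step:
  assumes "progression Z f a" "x \<in> elts E R" "n \<in> elts E Z"
  shows "itinerary Z f a (dbl x) n \<longleftrightarrow> itinerary Z f a x (f n)"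
  unfolding itinerary_def using reach_step[OF assms(1,2) _ assms(3)] by auto

text \<open>The possible distances between points with the same itinerary are bounded and closed under
  doubling.\<close>

lemma itinerary_separates_less:
  assumes prog: "progression Z f a" and x: "x \<in> interval" "y \<in> interval" "x \<prec> y"
    and same: "\<And>n. n \<in> elts E Z \<Longrightarrow> itinerary Z f a x n \<longleftrightarrow> itinerary Z f a y n"
  shows False
proof -
  \<comment> \<open>\<open>P d\<close> says that some two points of the interval at distance
    \<open>d\<close> share their itinerary; \<open>plus\<close> replaces ring addition for
    definability.\<close>
  define P where "P d \<longleftrightarrow> (\<exists>x \<in> elts E R. (\<ominus>\<^bsub>K\<^esub> e \<preceq> x \<and> x \<preceq> e) \<and>
    (\<ominus>\<^bsub>K\<^esub> e \<preceq> plus x d \<and> plus x d \<preceq> e) \<and>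
    (\<forall>n \<in> elts E Z. itinerary Z f a x n \<longleftrightarrow> itinerary Z f a (plus x d) n))" for d
  have P_iff: "P d \<longleftrightarrow> (\<exists>x \<in> interval. x \<oplus>\<^bsub>K\<^esub> d \<in> interval \<and>
    (\<forall>n \<in> elts E Z. itinerary Z f a x n \<longleftrightarrow> itinerary Z f a (x \<oplus>\<^bsub>K\<^esub> d) n))" if "d \<in> elts E R" for d
    using that unfolding P_def interval_def by auto
  have "\<exists>S. elts E S = {d \<in> elts E R. P d}"
    unfolding P_def
    by (intro separation def_intros definable_fun_plus definable_itinerary[OF prog])
  then obtain S where S: "elts E S = {d \<in> elts E R. P d}" by blast
  have R: "x \<in> elts E R" "y \<in> elts E R" using x unfolding interval_def by auto
  define c where "c = y \<oplus>\<^bsub>K\<^esub> \<ominus>\<^bsub>K\<^esub> x"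
  have "c \<in> elts E R" using R unfolding c_def by simp
  moreover have "x \<oplus>\<^bsub>K\<^esub> c = y"
    unfolding c_def using R K.r_neg2[of x y] K.a_comm[of y "\<ominus>\<^bsub>K\<^esub> x"] by simp
  ultimately have c: "c \<in> elts E S"
    using x same unfolding S by (auto simp: P_iff)
  show False
  proof (rule no_bounded_doubling[OF _ _ _ _ c])
    show "elts E S \<subseteq> elts E R" unfolding S by blast
    show "e \<oplus>\<^bsub>K\<^esub> e \<in> elts E R" by simp
    show "z \<prec> c" using x(3) less_iff_diff[of x y] R unfolding c_def by simp
    \<comment> \<open>The bound is the length of the interval.\<close>
    show "\<forall>d \<in> elts E S. d \<preceq> e \<oplus>\<^bsub>K\<^esub> e"
    proof (intro ballI notI)
      fix d assume "d \<in> elts E S" and less: "e \<oplus>\<^bsub>K\<^esub> e \<prec> d"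
      then obtain x where d: "d \<in> elts E R" and x: "x \<in> interval" "x \<oplus>\<^bsub>K\<^esub> d \<in> interval"
        unfolding S by (auto simp: P_iff)
      then have R: "x \<in> elts E R" "\<ominus>\<^bsub>K\<^esub> e \<preceq> x" "x \<oplus>\<^bsub>K\<^esub> d \<preceq> e" unfolding interval_def by auto
      have "\<ominus>\<^bsub>K\<^esub> e \<oplus>\<^bsub>K\<^esub> (e \<oplus>\<^bsub>K\<^esub> e) \<preceq> x \<oplus>\<^bsub>K\<^esub> (e \<oplus>\<^bsub>K\<^esub> e)"
        using R less_irrefl by (intro add_le_mono) auto
      then have "e \<preceq> x \<oplus>\<^bsub>K\<^esub> (e \<oplus>\<^bsub>K\<^esub> e)" using K.r_neg1[of e e] by simp
      moreover have "x \<oplus>\<^bsub>K\<^esub> (e \<oplus>\<^bsub>K\<^esub> e) \<prec> x \<oplus>\<^bsub>K\<^esub> d"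
        using add_less[of "e \<oplus>\<^bsub>K\<^esub> e" d x] less R d K.a_comm[of "e \<oplus>\<^bsub>K\<^esub> e" x] K.a_comm[of d x] by simp
      ultimately have "e \<prec> x \<oplus>\<^bsub>K\<^esub> d"
        using R d le_less_trans[of e "x \<oplus>\<^bsub>K\<^esub> (e \<oplus>\<^bsub>K\<^esub> e)" "x \<oplus>\<^bsub>K\<^esub> d"] by simp
      then show False using R by blast
    qed
    fix d assume "d \<in> elts E S"
    then obtain x where d: "d \<in> elts E R" and x: "x \<in> interval" "x \<oplus>\<^bsub>K\<^esub> d \<in> interval"
      and it: "\<And>n. n \<in> elts E Z \<Longrightarrow> itinerary Z f a x n \<longleftrightarrow> itinerary Z f a (x \<oplus>\<^bsub>K\<^esub> d) n"
      unfolding S by (auto simp: P_iff)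
    have R: "x \<in> elts E R" using x unfolding interval_def by auto
    have a: "a \<in> elts E Z" and f: "\<And>n. n \<in> elts E Z \<Longrightarrow> f n \<in> elts E Z"
      using prog unfolding progression_def by auto
    \<comment> \<open>The digit at \<open>a\<close> is the sign, so equal itineraries put both
      points on the same branch.\<close>
    have "x \<prec> z \<longleftrightarrow> x \<oplus>\<^bsub>K\<^esub> d \<prec> z"
      using it[OF a] itinerary_start[OF prog] R d by simp
    then have eq: "dbl (x \<oplus>\<^bsub>K\<^esub> d) = dbl x \<oplus>\<^bsub>K\<^esub> (d \<oplus>\<^bsub>K\<^esub> d)" using dbl_add R d by blast
    have "itinerary Z f a (dbl x) n \<longleftrightarrow> itinerary Z f a (dbl (x \<oplus>\<^bsub>K\<^esub> d)) n" if "n \<in> elts E Z" for n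
      using it[OF f[OF that]] itinerary_step[OF prog _ that] R d by simp
    moreover have "dbl x \<in> interval" "dbl (x \<oplus>\<^bsub>K\<^esub> d) \<in> interval" using x dbl_interval by auto
    ultimately have "P (d \<oplus>\<^bsub>K\<^esub> d)" using d unfolding P_iff[OF K_closed(1)[OF d d]] eq by blast
    then show "d \<oplus>\<^bsub>K\<^esub> d \<in> elts E S" using d unfolding S by simp
  qed
qed

text \<open>The reals are first squeezed into the interval, because the doubling argument needs
  bounded distances.\<close>

definition point_code :: "'a \<Rightarrow> ('a \<Rightarrow> 'a) \<Rightarrow> 'a \<Rightarrow> 'a \<Rightarrow> 'a \<Rightarrow> bool" where
  "point_code Z f a x n \<longleftrightarrow> (\<exists>y \<in> elts E R. squash x y \<and> itinerary Z f a y n)"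

lemma definable_point_code:
  assumes "progression Z f a" "definable_fun E s" "definable_fun E t"
  shows "definable E (\<lambda>v. point_code Z f a (s v) (t v))"
proof (rule definable_subst2[OF assms(2,3)])
  show "definable E (\<lambda>v. point_code Z f a (v 0) (v (Suc 0)))"
    unfolding point_code_def
    by (intro def_intros definable_itinerary[OF assms(1)] definable_squash)
qed

text \<open>The code of a real is the itinerary of its one value under \<open>squash\<close>;
  itineraries separate the interval, and \<open>squash\<close> is injective.\<close>

lemma point_code_separates:
  assumes prog: "progression Z f a" and x: "x \<in> elts E R" "x' \<in> elts E R"
    and same: "\<And>n. n \<in> elts E Z \<Longrightarrow> point_code Z f a x n \<longleftrightarrow> point_code Z f a x' n"
  shows "x = x'"
proof -
  obtain y where y: "y \<in> elts E R" "squash x y" using squash_total x by blast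
  obtain y' where y': "y' \<in> elts E R" "squash x' y'" using squash_total x by blast
  have "point_code Z f a x n \<longleftrightarrow> itinerary Z f a y n" for n
    unfolding point_code_def using y squash_unique[OF x(1) y(1) _ y(2)] by metis
  moreover have "point_code Z f a x' n \<longleftrightarrow> itinerary Z f a y' n" for n
    unfolding point_code_def using y' squash_unique[OF x(2) y'(1) _ y'(2)] by metis
  ultimately have it: "itinerary Z f a y n \<longleftrightarrow> itinerary Z f a y' n" if "n \<in> elts E Z" for n
    using same that by simp
  have I: "y \<in> interval" "y' \<in> interval" using squash_range x y y' by auto
  have "\<not> y \<prec> y'" "\<not> y' \<prec> y"
    using itinerary_separates_less[OF prog I] itinerary_separates_less[OF prog I(2,1)] it by auto
  then have "y = y'" using less_linear y y' by blast
  then show ?thesis using squash_inject x y y' by blast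
qed

section \<open>Rigid relations\<close>

text \<open>Allows arguing with a definable predicate instead of a set of pairs; on \<open>A\<close>
  the two agree.\<close>

lemma admits_rigid_relationI:
  assumes "definable E (\<lambda>v. W (v 0) (v (Suc 0)))"
    and "\<And>\<pi> a. bijection E \<pi> A A \<Longrightarrow>
      (\<And>p q. p \<in> elts E A \<Longrightarrow> q \<in> elts E A \<Longrightarrow> W p q \<longleftrightarrow> W (app E \<pi> p) (app E \<pi> q)) \<Longrightarrow>
      a \<in> elts E A \<Longrightarrow> app E \<pi> a = a"
  shows "admits_rigid_relation E A"
proof -
  obtain r where r: "elts E r \<subseteq> cross E A A"
    "\<forall>p q. related E r p q = (p \<in> elts E A \<and> q \<in> elts E A \<and> W p q)"
    using relation_comprehension[OF assms(1), of A A] by (elim exE conjE)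
  have "app E \<pi> a = a" if \<pi>: "automorphism E \<pi> A r" and a: "a \<in> elts E A" for \<pi> a
  proof (rule assms(2)[OF _ _ a])
    show bij: "bijection E \<pi> A A" using \<pi> unfolding automorphism_def by blast
    fix p q assume "p \<in> elts E A" "q \<in> elts E A"
    then show "W p q \<longleftrightarrow> W (app E \<pi> p) (app E \<pi> q)"
      using \<pi> app_in[of \<pi> A A] bij unfolding automorphism_def bijection_def r(2)[rule_format] by simp
  qed
  then show ?thesis
    using r(1) unfolding admits_rigid_relation_def relation_on_def rigid_def by blast
qed

section \<open>Sets that contain a progression\<close>

lemma progression_cases:
  assumes prog: "progression Z f a" and n: "n \<in> elts E Z"
  shows "n = a \<or> (\<exists>m \<in> elts E Z. n = f m)"
proof (rule progression_induct[OF prog n])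
  show "definable E (\<lambda>v. v 0 = a \<or> (\<exists>m \<in> elts E Z. v 0 = f m))"
    by (intro def_intros definable_fun_progression[OF prog])
qed auto

lemma admits_rigid_relation_of_progression:
  assumes A: "elts E A \<subseteq> cross E R B"
    and irrefl: "irreflexive E B R\<^sub>1" and hered: "hereditarily_rigid E B R\<^sub>1"
    and Z: "elts E Z \<subseteq> elts E A" and prog: "progression Z f a"
  shows "admits_rigid_relation E A"
proof -
  \<comment> \<open>The clauses give the successor on \<open>Z\<close>, the codes from
    \<open>Z\<close> to its complement, and reflexive fibres outside \<open>Z\<close>; nothing leads
    from the complement into \<open>Z\<close>.\<close>
  define W where "W p q \<longleftrightarrow>
    p \<in> elts E Z \<and> q \<in> elts E Z \<and> q = f p \<or>
    p \<in> elts E Z \<and> q \<notin> elts E Z \<and> (\<exists>x b. q = opair E x b \<and> point_code Z f a x p) \<or>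
    p \<notin> elts E Z \<and> q \<notin> elts E Z \<and>
      (\<exists>x b c. p = opair E x b \<and> q = opair E x c \<and> (b = c \<or> related E R\<^sub>1 b c))" for p q
  have f: "f n \<in> elts E Z" "f n \<noteq> a" "f n \<noteq> n" if "n \<in> elts E Z" for n
    using prog that progression_neq[OF prog that] unfolding progression_def by auto
  have W_succ: "W p q \<longleftrightarrow> q = f p" if "p \<in> elts E Z" "q \<in> elts E Z" for p q
    using that unfolding W_def by simp
  have W_code: "W p (opair E x b) \<longleftrightarrow> point_code Z f a x p"
    if "p \<in> elts E Z" "opair E x b \<notin> elts E Z" for p x b
    using that unfolding W_def by simp
  have W_fibre: "W (opair E x b) (opair E x c) \<longleftrightarrow> b = c \<or> related E R\<^sub>1 b c"
    if "opair E x b \<notin> elts E Z" "opair E x c \<notin> elts E Z" for x b c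
    using that unfolding W_def by simp
  have W_refl: "W p p \<longleftrightarrow> p \<notin> elts E Z" if p: "p \<in> elts E A" for p
  proof -
    obtain x b where "p = opair E x b" using A p unfolding cross_def by blast
    then show ?thesis using W_succ[of p p] f(3)[of p] W_fibre[of x b b] by metis
  qed
  show ?thesis
  proof (rule admits_rigid_relationI[of W])
    show "definable E (\<lambda>v. W (v 0) (v (Suc 0)))"
      unfolding W_def
      by (intro def_intros definable_fun_progression[OF prog] definable_point_code[OF prog])
    fix \<pi> p
    assume \<pi>: "bijection E \<pi> A A" and p: "p \<in> elts E A"
      and pres: "\<And>p q. p \<in> elts E A \<Longrightarrow> q \<in> elts E A \<Longrightarrow> W p q \<longleftrightarrow> W (app E \<pi> p) (app E \<pi> q)"
    have func: "is_function E \<pi> A A" and bij: "bij_betw (app E \<pi>) (elts E A) (elts E A)"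
      using \<pi> unfolding bijection_def by auto
    have closed: "app E \<pi> p \<in> elts E A" if "p \<in> elts E A" for p
      using app_in[OF func that] .
    \<comment> \<open>The points of \<open>Z\<close> are exactly the points of \<open>A\<close>
      without a loop.\<close>
    have Z_iff: "app E \<pi> p \<in> elts E Z \<longleftrightarrow> p \<in> elts E Z" if "p \<in> elts E A" for p
      using W_refl[OF that] W_refl[OF closed[OF that]] pres[OF that that] by blast
    have "a \<in> elts E Z" using prog unfolding progression_def by blast
    \<comment> \<open>Within \<open>Z\<close> only \<open>a\<close> has no predecessor: if
      \<open>\<pi>\<close> sent it to \<open>f k\<close>, the preimage of \<open>k\<close> would be
      a predecessor of \<open>a\<close>.\<close>
    have fix_start: "app E \<pi> a = a"
    proof (rule ccontr)
      assume "app E \<pi> a \<noteq> a"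
      then obtain k where k: "k \<in> elts E Z" "app E \<pi> a = f k"
        using progression_cases[OF prog, of "app E \<pi> a"] Z_iff[of a] Z \<open>a \<in> elts E Z\<close> by blast
      have "k \<in> app E \<pi> ` elts E A" using bij k(1) Z unfolding bij_betw_def by blast
      then obtain m where m: "m \<in> elts E A" "app E \<pi> m = k" by blast
      then have "m \<in> elts E Z" using Z_iff k by blast
      moreover have "W m a"
        using pres[of m a] m k Z W_succ[of k "f k"] f(1)[of k] \<open>a \<in> elts E Z\<close> by auto
      ultimately show False using W_succ[of m a] f(2)[of m] \<open>a \<in> elts E Z\<close> by auto
    qed
    \<comment> \<open>Fixed points are expressed by \<open>related\<close> because
      \<open>app\<close> may fail to be definable, and induction needs a definable
      predicate.\<close>
    have "related E \<pi> n n" if n: "n \<in> elts E Z" for n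
    proof (rule progression_induct[OF prog n])
      show "definable E (\<lambda>v. related E \<pi> (v 0) (v 0))" by (intro def_intros)
      show "related E \<pi> a a"
        using fix_start related_iff_app[OF func, of a a] Z \<open>a \<in> elts E Z\<close> by auto
      fix n assume n: "n \<in> elts E Z" "related E \<pi> n n"
      have nA: "n \<in> elts E A" "f n \<in> elts E A" using n(1) f(1) Z by auto
      have "app E \<pi> n = n" using n(2) related_iff_app[OF func nA(1), of n] by simp
      moreover have "W n (f n)" using W_succ n f(1) by blast
      ultimately have "W n (app E \<pi> (f n))" using pres[OF nA] by simp
      then have "app E \<pi> (f n) = f n"
        using W_succ[of n "app E \<pi> (f n)"] Z_iff[OF nA(2)] n f(1) by blast
      then show "related E \<pi> (f n) (f n)" using related_iff_app[OF func nA(2)] by simp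
    qed
    then have fix_Z: "app E \<pi> n = n" if "n \<in> elts E Z" for n
      using related_iff_app[OF func, of n n] that Z by auto
    have first: "\<exists>c. app E \<pi> (opair E x b) = opair E x c" if xb: "opair E x b \<in> elts E A" for x b
    proof (cases "opair E x b \<in> elts E Z")
      case True
      then show ?thesis using fix_Z by blast
    next
      case False
      obtain y c where yc: "app E \<pi> (opair E x b) = opair E y c"
        using closed[OF xb] A unfolding cross_def by blast
      have notin: "opair E y c \<notin> elts E Z" using Z_iff[OF xb] False yc by simp
      have "x \<in> elts E R" "y \<in> elts E R" using A xb closed[OF xb] unfolding yc by auto
      moreover have "point_code Z f a x n \<longleftrightarrow> point_code Z f a y n" if "n \<in> elts E Z" for n
        using pres[of n "opair E x b"] fix_Z[OF that] W_code[OF that False] W_code[OF that notin]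
          xb yc Z that by auto
      ultimately have "x = y" using point_code_separates[OF prog] by blast
      then show ?thesis using yc by blast
    qed
    show "app E \<pi> p = p"
    proof (cases "p \<in> elts E Z")
      case True
      then show ?thesis by (rule fix_Z)
    next
      case False
      show ?thesis
      proof (rule fibrewise_automorphism_trivial[OF A hered \<pi> first, where D = "\<lambda>p. p \<notin> elts E Z"])
        show "definable E (\<lambda>v. v 0 \<notin> elts E Z)" by (intro def_intros)
        show "app E \<pi> q \<notin> elts E Z \<longleftrightarrow> q \<notin> elts E Z" if "q \<in> elts E A" for q
          using Z_iff[OF that] by simp
        fix x b b' c c'
        assume b: "opair E x b \<in> elts E A" "opair E x b' \<in> elts E A"
          "opair E x b \<notin> elts E Z" "opair E x b' \<notin> elts E Z"
          and c: "app E \<pi> (opair E x b) = opair E x c" "app E \<pi> (opair E x b') = opair E x c'"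
        have notin: "opair E x c \<notin> elts E Z" "opair E x c' \<notin> elts E Z"
          using Z_iff[OF b(1)] Z_iff[OF b(2)] b c by auto
        \<comment> \<open>The reflexive closure loses nothing: injectivity matches the diagonals,
          and on the diagonal \<open>R\<^sub>1\<close> fails by irreflexivity.\<close>
        have "c = c' \<longleftrightarrow> b = b'"
          using bij b(1,2) c unfolding bij_betw_def inj_on_def by (metis opair_inject)
        moreover have "b = b' \<or> related E R\<^sub>1 b b' \<longleftrightarrow> c = c' \<or> related E R\<^sub>1 c c'"
          using pres[OF b(1,2)] W_fibre[OF b(3,4)] W_fibre[OF notin] c by simp
        moreover have "b \<in> elts E B" "c \<in> elts E B"
          using A b(1) closed[OF b(1)] c(1) by auto
        ultimately show "related E R\<^sub>1 b b' \<longleftrightarrow> related E R\<^sub>1 c c'"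
          using irrefl unfolding irreflexive_def by blast
      qed (use first p False in auto)
    qed
  qed
qed

section \<open>Sets without a progression\<close>

lemma admits_rigid_relation_of_no_progression:
  assumes A: "elts E A \<subseteq> cross E R B"
    and hered: "hereditarily_rigid E B R\<^sub>1"
    and none: "\<And>Z f a. elts E Z \<subseteq> elts E A \<Longrightarrow> \<not> progression Z f a"
  shows "admits_rigid_relation E A"
proof -
  define W where "W p q \<longleftrightarrow> (\<exists>x b y c. p = opair E x b \<and> q = opair E y c \<and>
    (x \<prec> y \<or> x = y \<and> related E R\<^sub>1 b c))" for p q
  have W: "W (opair E x b) (opair E y c) \<longleftrightarrow> x \<prec> y \<or> x = y \<and> related E R\<^sub>1 b c" for x b y c
    unfolding W_def by simp
  show ?thesis
  proof (rule admits_rigid_relationI[of W])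
    show "definable E (\<lambda>v. W (v 0) (v (Suc 0)))"
      unfolding W_def by (intro def_intros)
    fix \<pi> p
    assume \<pi>: "bijection E \<pi> A A" and p: "p \<in> elts E A"
      and pres: "\<And>p q. p \<in> elts E A \<Longrightarrow> q \<in> elts E A \<Longrightarrow> W p q \<longleftrightarrow> W (app E \<pi> p) (app E \<pi> q)"
    have func: "is_function E \<pi> A A" and bij: "bij_betw (app E \<pi>) (elts E A) (elts E A)"
      using \<pi> unfolding bijection_def by auto
    have closed: "app E \<pi> p \<in> elts E A" if "p \<in> elts E A" for p
      using app_in[OF func that] .
    have fapp: "fapp \<pi> p = app E \<pi> p" if "p \<in> elts E A" for p
      using fapp_eq_app[OF func that] .
    \<comment> \<open>A definable property gained at the first step from \<open>q\<close> and kept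
      ever after would make the orbit of \<open>q\<close> a progression.\<close>
    have no_escape: False
      if "q \<in> elts E A" "definable E (\<lambda>v. P (v 0))" "P (app E \<pi> q)" "\<not> P q"
        "\<And>p. p \<in> elts E A \<Longrightarrow> P p \<Longrightarrow> P (app E \<pi> p)" for q P
    proof -
      have "\<exists>Z. elts E Z \<subseteq> elts E A \<and> progression Z (fapp \<pi>) q"
      proof (rule orbit_progression[where P = P])
        show "definable_fun E (\<lambda>v. fapp \<pi> (v 0))" by (intro definable_fun_fapp def_intros)
        show "fapp \<pi> ` elts E A \<subseteq> elts E A" using fapp closed by auto
        show "inj_on (fapp \<pi>) (elts E A)"
          using bij fapp unfolding bij_betw_def by (simp cong: inj_on_cong)
      qed (use that fapp in auto)
      then show False using none by blast
    qed
    have decomp: "\<exists>x b. q = opair E x b \<and> x \<in> elts E R" if "q \<in> elts E A" for q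
      using that A unfolding cross_def by blast
    have first: "\<exists>c. app E \<pi> (opair E x b) = opair E x c" if xb: "opair E x b \<in> elts E A" for x b
    proof -
      have x: "x \<in> elts E R" using xb A by auto
      obtain y c where yc: "app E \<pi> (opair E x b) = opair E y c" and y: "y \<in> elts E R"
        using decomp[OF closed[OF xb]] by blast
      have "\<not> x \<prec> y"
      proof
        assume "x \<prec> y"
        \<comment> \<open>The property is having first coordinate above \<open>x\<close>. Such a
          \<open>q\<close> lies after \<open>opair E x b\<close>, so its image lies after
          \<open>opair E y c\<close> and has first coordinate at least \<open>y\<close>.\<close>
        show False
        proof (rule no_escape[OF xb, of "\<lambda>q. \<exists>w d. q = opair E w d \<and> x \<prec> w"])
          fix q assume q: "q \<in> elts E A" "\<exists>w d. q = opair E w d \<and> x \<prec> w"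
          obtain w d where wd: "app E \<pi> q = opair E w d" "w \<in> elts E R"
            using decomp[OF closed[OF q(1)]] by blast
          have "W (opair E x b) q" using q(2) W by auto
          then have "W (opair E y c) (opair E w d)" using pres[OF xb q(1)] yc wd by simp
          then have "x \<prec> w" using \<open>x \<prec> y\<close> less_trans[OF x y wd(2)] unfolding W by blast
          then show "\<exists>w d. app E \<pi> q = opair E w d \<and> x \<prec> w" using wd by blast
        qed (use \<open>x \<prec> y\<close> yc x less_irrefl in \<open>auto intro!: def_intros\<close>)
      qed
      moreover have "\<not> y \<prec> x"
      proof
        assume "y \<prec> x"
        \<comment> \<open>The mirror image, with first coordinates below \<open>x\<close>.\<close>
        show False
        proof (rule no_escape[OF xb, of "\<lambda>q. \<exists>w d. q = opair E w d \<and> w \<prec> x"])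
          fix q assume q: "q \<in> elts E A" "\<exists>w d. q = opair E w d \<and> w \<prec> x"
          obtain w d where wd: "app E \<pi> q = opair E w d" "w \<in> elts E R"
            using decomp[OF closed[OF q(1)]] by blast
          have "W q (opair E x b)" using q(2) W by auto
          then have "W (opair E w d) (opair E y c)" using pres[OF q(1) xb] yc wd by simp
          then have "w \<prec> x" using \<open>y \<prec> x\<close> less_trans[OF wd(2) y x] unfolding W by blast
          then show "\<exists>w d. app E \<pi> q = opair E w d \<and> w \<prec> x" using wd by blast
        qed (use \<open>y \<prec> x\<close> yc x less_irrefl in \<open>auto intro!: def_intros\<close>)
      qed
      ultimately have "x = y" using less_linear x y by blast
      then show ?thesis using yc by blast
    qed
    show "app E \<pi> p = p"
    proof (rule fibrewise_automorphism_trivial[OF A hered \<pi> first, where D = "\<lambda>p. True"])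
      fix x b b' c c'
      assume b: "opair E x b \<in> elts E A" "opair E x b' \<in> elts E A"
        and c: "app E \<pi> (opair E x b) = opair E x c" "app E \<pi> (opair E x b') = opair E x c'"
      have "x \<in> elts E R" using A b by auto
      \<comment> \<open>Inside one fibre the comparison of first coordinates is void, and
        \<open>W\<close> reduces to \<open>R\<^sub>1\<close>.\<close>
      then show "related E R\<^sub>1 b b' \<longleftrightarrow> related E R\<^sub>1 c c'"
        using pres[OF b] c less_irrefl by (simp add: W)
    qed (use p in \<open>auto intro: def_intros\<close>)
  qed
qed

end

section \<open>Ordinals as hereditarily rigid sets\<close>

context zf
begin

text \<open>Membership works: in any subset, consider the least point moved by an
  automorphism.\<close>

lemma ordinal_membership_hereditarily_rigid:
  assumes "ordinal E \<gamma>"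
  shows "\<exists>r. relation_on E r \<gamma> \<and> irreflexive E \<gamma> r \<and> hereditarily_rigid E \<gamma> r"
proof -
  have irrefl: "\<not> E x x" if "x \<in> elts E \<gamma>" for x
    using assms[unfolded ordinal_def] that by (elim conjE) (rule bspec)
  have trans: "E x w" if "x \<in> elts E \<gamma>" "y \<in> elts E \<gamma>" "w \<in> elts E \<gamma>" "E x y" "E y w" for x y w
    using assms[unfolded ordinal_def, THEN conjunct2, THEN conjunct2, THEN conjunct1] that by blast
  have linear: "E x y \<or> x = y \<or> E y x" if "x \<in> elts E \<gamma>" "y \<in> elts E \<gamma>" for x y
    using assms[unfolded ordinal_def, THEN conjunct2, THEN conjunct2, THEN conjunct2, THEN conjunct1]
      that by blast
  have least: "\<exists>m \<in> elts E s. \<forall>y \<in> elts E s. m = y \<or> E m y"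
    if "elts E s \<subseteq> elts E \<gamma>" "elts E s \<noteq> {}" for s
    using assms[unfolded ordinal_def, THEN conjunct2, THEN conjunct2, THEN conjunct2, THEN conjunct2]
      that by blast
  have "definable E (\<lambda>v. E (v 0) (v (Suc 0)))" by (intro def_intros)
  from relation_comprehension[OF this, of \<gamma> \<gamma>] obtain r where r: "elts E r \<subseteq> cross E \<gamma> \<gamma>"
    "\<forall>x y. related E r x y = (x \<in> elts E \<gamma> \<and> y \<in> elts E \<gamma> \<and> E x y)"
    by (elim exE conjE)
  have "hereditarily_rigid E \<gamma> r"
    unfolding hereditarily_rigid_def rigid_def
  proof (intro allI impI ballI, elim conjE)
    fix B r' \<pi> b
    assume B: "elts E B \<subseteq> elts E \<gamma>" and r': "elts E r' = elts E r \<inter> cross E B B"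
      and \<pi>: "automorphism E \<pi> B r'" and b: "b \<in> elts E B"
    have func: "is_function E \<pi> B B" and bij: "bij_betw (app E \<pi>) (elts E B) (elts E B)"
      using \<pi> unfolding automorphism_def bijection_def by auto
    have closed: "app E \<pi> x \<in> elts E B" if "x \<in> elts E B" for x using app_in[OF func that] .
    have rel: "related E r' x y \<longleftrightarrow> E x y" if "x \<in> elts E B" "y \<in> elts E B" for x y
      using r(2)[rule_format, of x y] that B unfolding related_def r' by auto
    have pres: "E x y \<longleftrightarrow> E (app E \<pi> x) (app E \<pi> y)" if "x \<in> elts E B" "y \<in> elts E B" for x y
      using \<pi> that rel closed unfolding automorphism_def by simp
    have inj: "x = y" if "x \<in> elts E B" "y \<in> elts E B" "app E \<pi> x = app E \<pi> y" for x y
      using bij that unfolding bij_betw_def inj_on_def by blast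
    \<comment> \<open>The moved points must form a set of the universe before leastness applies;
      \<open>related\<close> makes them definable.\<close>
    have "\<exists>s. elts E s = {x \<in> elts E B. \<not> related E \<pi> x x}"
      by (intro separation def_intros)
    then obtain s where "elts E s = {x \<in> elts E B. \<not> related E \<pi> x x}" by blast
    also have "\<dots> = {x \<in> elts E B. app E \<pi> x \<noteq> x}"
      using related_iff_app[OF func] by metis
    finally have s: "elts E s = {x \<in> elts E B. app E \<pi> x \<noteq> x}" .
    show "app E \<pi> b = b"
    proof (rule ccontr)
      assume "app E \<pi> b \<noteq> b"
      then obtain m where m: "m \<in> elts E s" and min: "\<And>y. y \<in> elts E s \<Longrightarrow> m = y \<or> E m y"
        using least[of s] B b unfolding s by blast
      have mB: "m \<in> elts E B" "app E \<pi> m \<noteq> m" using m unfolding s by auto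
      have below: "app E \<pi> y = y" if "y \<in> elts E B" "E y m" for y
      proof (rule ccontr)
        assume "app E \<pi> y \<noteq> y"
        then have "m = y \<or> E m y" using min[of y] that unfolding s by blast
        then show False using irrefl[of m] trans[of m y m] that mB B by blast
      qed
      show False
      \<comment> \<open>If \<open>m\<close> moves down, its image is a fixed point with two
        preimages. If it moves up, its preimage lies below it and is moved, against
        minimality.\<close>
      proof (cases "E (app E \<pi> m) m")
        case True
        then show False using below[of "app E \<pi> m"] closed mB inj[of "app E \<pi> m" m] by blast
      next
        case False
        then have less: "E m (app E \<pi> m)"
          using linear[OF subsetD[OF B mB(1)] subsetD[OF B closed[OF mB(1)]]] mB(2) by simp
        have "m \<in> app E \<pi> ` elts E B" using bij mB(1) unfolding bij_betw_def by simp
        then obtain c where c: "c \<in> elts E B" "app E \<pi> c = m" by (elim imageE) simp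
        have "E c m" using pres[OF c(1) mB(1)] less c(2) by simp
        then show False using below[OF c(1)] c(2) mB(2) by simp
      qed
    qed
  qed
  moreover have "irreflexive E \<gamma> r"
    using irrefl unfolding irreflexive_def r(2)[rule_format] by blast
  ultimately show ?thesis using r(1) unfolding relation_on_def by blast
qed

end

theorem theorem3:
  fixes E :: "'a \<Rightarrow> 'a \<Rightarrow> bool"
    and R pl tm z e lt :: 'a
  assumes "ZF E"
    and "real_field E R pl tm z e lt"
  shows "(\<forall>B R\<^sub>1. relation_on E R\<^sub>1 B \<and> irreflexive E B R\<^sub>1 \<and> hereditarily_rigid E B R\<^sub>1 \<longrightarrow>
            (\<forall>A. elts E A \<subseteq> cross E R B \<longrightarrow> admits_rigid_relation E A)) \<and>
         (\<forall>\<gamma>. ordinal E \<gamma> \<longrightarrow>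
            (\<forall>A. elts E A \<subseteq> cross E R \<gamma> \<longrightarrow> admits_rigid_relation E A))"
proof -
  interpret real_line E R pl tm z e lt
    using assms by unfold_locales
  \<comment> \<open>Whether \<open>A\<close> contains a progression is decided by excluded middle;
    no choice is made inside the universe.\<close>
  have main: "admits_rigid_relation E A"
    if "irreflexive E B R\<^sub>1" "hereditarily_rigid E B R\<^sub>1" "elts E A \<subseteq> cross E R B" for B R\<^sub>1 A
    using admits_rigid_relation_of_progression[OF that(3,1,2)]
      admits_rigid_relation_of_no_progression[OF that(3,2)] by blast
  then show ?thesis
    using ordinal_membership_hereditarily_rigid by blast
qed

end
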